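(* Let $R$ be a commutative $\mathbf{Q}$-algebra and let $\mathfrak{g}=\bigoplus_{n\ge 1}\mathfrak{g}_n$ be a Lie algebra over $R$ graded in the set $\mathbf{N}^*$ of positive integers (so $[\mathfrak{g}_m,\mathfrak{g}_n]\subset\mathfrak{g}_{m+n}$). Then the reduced Koszul map $\bar\eta:H_3(\mathfrak{g})\to\mathrm{Kill}(\mathfrak{g})$ is zero.
   Context: Tensor, exterior and symmetric powers are over the commutative ground ring $R$. $H_*(\mathfrak{g})$ is the homology of the Chevalley–Eilenberg complex $\Lambda^*\mathfrak{g}$ with $\partial_n(x_1\wedge\dots\wedge x_n)=\sum_{i<j}(-1)^{i+j}[x_i,x_j]\wedge x_1\wedge\dots\wedge\hat{x_i}\wedge\dots\wedge\hat{x_j}\wedge\dots\wedge x_n$, and $Z_3(\mathfrak{g})=\ker\partial_3$. Writing $x\odot y$ for the product in the symmetric square $S^2\mathfrak{g}$, the Killing module $\mathrm{Kill}(\mathfrak{g})$ is the cokernel of $\mathfrak{g}^{\otimes 3}\to S^2\mathfrak{g}$, $x\otimes y\otimes z\mapsto [x,y]\odot z-x\odot[y,z]$. The Koszul map $\eta:\Lambda^3\mathfrak{g}\to\mathrm{Kill}(\mathfrak{g})$ sends $x\wedge y\wedge z$ to the class of $x\odot[y,z]$; it vanishes on 3-boundaries, and the reduced Koszul map $\bar\eta:H_3(\mathfrak{g})\to\mathrm{Kill}(\mathfrak{g})$ is induced by restricting $\eta$ to $Z_3(\mathfrak{g})$. *)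

theory Defs
  imports "HOL-Algebra.AbelCoset" "HOL-Algebra.Module" "HOL-Algebra.Algebraic_Closure_Type"
begin

text \<open>
  Module records inherit the fields \<open>mult\<close> and \<open>one\<close> from rings; they play no role for
  modules and are left \<open>undefined\<close> in the constructions below.
\<close>

record ('r, 'g) lie = "('r, 'g) module" +
  bracket :: "'g \<Rightarrow> 'g \<Rightarrow> 'g"  (\<open>\<lbrace>_,/ _\<rbrace>\<index>\<close>)

locale lie_algebra = module R L for R :: "('r, 'z) ring_scheme" and L :: "('r, 'g, 'y) lie_scheme" (structure) +
  assumes bracket_closed:
      "\<lbrakk>x \<in> carrier L; y \<in> carrier L\<rbrakk> \<Longrightarrow> \<lbrace>x, y\<rbrace> \<in> carrier L"
    and bracket_add_l:
      "\<lbrakk>x \<in> carrier L; y \<in> carrier L; z \<in> carrier L\<rbrakk> \<Longrightarrow>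
        \<lbrace>x \<oplus>\<^bsub>L\<^esub> y, z\<rbrace> = \<lbrace>x, z\<rbrace> \<oplus>\<^bsub>L\<^esub> \<lbrace>y, z\<rbrace>"
    and bracket_add_r:
      "\<lbrakk>x \<in> carrier L; y \<in> carrier L; z \<in> carrier L\<rbrakk> \<Longrightarrow>
        \<lbrace>x, y \<oplus>\<^bsub>L\<^esub> z\<rbrace> = \<lbrace>x, y\<rbrace> \<oplus>\<^bsub>L\<^esub> \<lbrace>x, z\<rbrace>"
    and bracket_smult_l:
      "\<lbrakk>a \<in> carrier R; x \<in> carrier L; y \<in> carrier L\<rbrakk> \<Longrightarrow>
        \<lbrace>a \<odot>\<^bsub>L\<^esub> x, y\<rbrace> = a \<odot>\<^bsub>L\<^esub> \<lbrace>x, y\<rbrace>"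
    and bracket_smult_r:
      "\<lbrakk>a \<in> carrier R; x \<in> carrier L; y \<in> carrier L\<rbrakk> \<Longrightarrow>
        \<lbrace>x, a \<odot>\<^bsub>L\<^esub> y\<rbrace> = a \<odot>\<^bsub>L\<^esub> \<lbrace>x, y\<rbrace>"
    and bracket_self: "x \<in> carrier L \<Longrightarrow> \<lbrace>x, x\<rbrace> = \<zero>\<^bsub>L\<^esub>"
    and jacobi:
      "\<lbrakk>x \<in> carrier L; y \<in> carrier L; z \<in> carrier L\<rbrakk> \<Longrightarrow>
        \<lbrace>x, \<lbrace>y, z\<rbrace>\<rbrace> \<oplus>\<^bsub>L\<^esub> \<lbrace>y, \<lbrace>z, x\<rbrace>\<rbrace> \<oplus>\<^bsub>L\<^esub> \<lbrace>z, \<lbrace>x, y\<rbrace>\<rbrace> = \<zero>\<^bsub>L\<^esub>"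

text \<open>
  Internal direct sums. Families indexed by \<open>I\<close> are functions on the whole index type that
  vanish outside \<open>I\<close>, which makes the decomposition unique as a function.
\<close>

definition direct_sum_decomposition ::
  "('r, 'z) ring_scheme \<Rightarrow> ('r, 'g, 'y) module_scheme \<Rightarrow> 'i set \<Rightarrow> ('i \<Rightarrow> 'g set) \<Rightarrow> bool" where
  "direct_sum_decomposition R M I G \<longleftrightarrow>
    (\<forall>i\<in>I. submodule (G i) R M) \<and>
    (\<forall>x\<in>carrier M. \<exists>!f. (\<forall>i\<in>I. f i \<in> G i) \<and> (\<forall>i. i \<notin> I \<longrightarrow> f i = \<zero>\<^bsub>M\<^esub>) \<and>
        finite {i. f i \<noteq> \<zero>\<^bsub>M\<^esub>} \<and> x = (\<Oplus>\<^bsub>M\<^esub>i\<in>{i. f i \<noteq> \<zero>\<^bsub>M\<^esub>}. f i))"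

definition lie_grading_pos ::
  "('r, 'z) ring_scheme \<Rightarrow> ('r, 'g, 'y) lie_scheme \<Rightarrow> (nat \<Rightarrow> 'g set) \<Rightarrow> bool" where
  "lie_grading_pos R L G \<longleftrightarrow>
    direct_sum_decomposition R L {1..} G \<and>
    (\<forall>m\<ge>1. \<forall>n\<ge>1. \<forall>x\<in>G m. \<forall>y\<in>G n. \<lbrace>x, y\<rbrace>\<^bsub>L\<^esub> \<in> G (m + n))"

definition free_module :: "('r, 'z) ring_scheme \<Rightarrow> 'x set \<Rightarrow> ('r, 'x \<Rightarrow> 'r) module" where
  "free_module R B =
    \<lparr>carrier = {f. (\<forall>x\<in>B. f x \<in> carrier R) \<and> (\<forall>x. x \<notin> B \<longrightarrow> f x = \<zero>\<^bsub>R\<^esub>) \<and>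
                   finite {x. f x \<noteq> \<zero>\<^bsub>R\<^esub>}},
     monoid.mult = undefined, one = undefined,
     ring.zero = (\<lambda>x. \<zero>\<^bsub>R\<^esub>), add = (\<lambda>f g x. f x \<oplus>\<^bsub>R\<^esub> g x),
     module.smult = (\<lambda>a f x. a \<otimes>\<^bsub>R\<^esub> f x)\<rparr>"

definition free_gen :: "('r, 'z) ring_scheme \<Rightarrow> 'x \<Rightarrow> 'x \<Rightarrow> 'r" where
  "free_gen R x = (\<lambda>y. if y = x then \<one>\<^bsub>R\<^esub> else \<zero>\<^bsub>R\<^esub>)"

definition free_extension ::
  "('r, 'z) ring_scheme \<Rightarrow> ('r, 'n, 'y) module_scheme \<Rightarrow> ('x \<Rightarrow> 'n) \<Rightarrow> ('x \<Rightarrow> 'r) \<Rightarrow> 'n" where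
  "free_extension R N \<phi> f = (\<Oplus>\<^bsub>N\<^esub>x\<in>{x. f x \<noteq> \<zero>\<^bsub>R\<^esub>}. f x \<odot>\<^bsub>N\<^esub> \<phi> x)"

definition submodule_gen ::
  "('r, 'z) ring_scheme \<Rightarrow> ('r, 'n, 'y) module_scheme \<Rightarrow> 'n set \<Rightarrow> 'n set" where
  "submodule_gen R M S = (\<lambda>H. submodule H R M) hull S"

definition quot_module ::
  "('r, 'n, 'y) module_scheme \<Rightarrow> 'n set \<Rightarrow> ('r, 'n set) module" where
  "quot_module M N =
    \<lparr>carrier = a_rcosets\<^bsub>M\<^esub> N,
     monoid.mult = undefined, one = undefined,
     ring.zero = N, add = set_add M,
     module.smult = (\<lambda>a C. \<Union>x\<in>C. N +>\<^bsub>M\<^esub> (a \<odot>\<^bsub>M\<^esub> x))\<rparr>"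

text \<open>
  The map induced on a quotient by \<open>h\<close>: a coset \<open>C\<close> goes to the common value of \<open>h\<close> on \<open>C\<close>
  (as in the first isomorphism theorem of HOL-Algebra). It is meaningful when \<open>h\<close> is constant
  on cosets.
\<close>

definition quot_induced :: "('n \<Rightarrow> 'k) \<Rightarrow> 'n set \<Rightarrow> 'k" where
  "quot_induced h C = the_elem (h ` C)"

text \<open>
  All three are presented as the free \<open>R\<close>-module on \<open>n\<close>-tuples of elements of \<open>M\<close> (lists of
  length \<open>n\<close>), modulo the relations expressing multilinearity and a set \<open>E\<close> of further relations.
\<close>

definition tuples :: "('r, 'g, 'y) module_scheme \<Rightarrow> nat \<Rightarrow> 'g list set" where
  "tuples M n = {xs. set xs \<subseteq> carrier M \<and> length xs = n}"

definition multilinear_rels ::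
  "('r, 'z) ring_scheme \<Rightarrow> ('r, 'g, 'y) module_scheme \<Rightarrow> nat \<Rightarrow> ('g list \<Rightarrow> 'r) set" where
  "multilinear_rels R M n =
    (let F = free_module R (tuples M n) in
      {free_gen R (xs[i := x \<oplus>\<^bsub>M\<^esub> y]) \<ominus>\<^bsub>F\<^esub>
         (free_gen R (xs[i := x]) \<oplus>\<^bsub>F\<^esub> free_gen R (xs[i := y])) | xs i x y.
         xs \<in> tuples M n \<and> i < n \<and> x \<in> carrier M \<and> y \<in> carrier M} \<union>
      {free_gen R (xs[i := a \<odot>\<^bsub>M\<^esub> x]) \<ominus>\<^bsub>F\<^esub> a \<odot>\<^bsub>F\<^esub> free_gen R (xs[i := x]) | xs i a x.
         xs \<in> tuples M n \<and> i < n \<and> a \<in> carrier R \<and> x \<in> carrier M})"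

definition tuple_rels ::
  "('r, 'z) ring_scheme \<Rightarrow> ('r, 'g, 'y) module_scheme \<Rightarrow> nat \<Rightarrow> ('g list \<Rightarrow> 'r) set
    \<Rightarrow> ('g list \<Rightarrow> 'r) set" where
  "tuple_rels R M n E =
    submodule_gen R (free_module R (tuples M n)) (multilinear_rels R M n \<union> E)"

definition tuple_quot ::
  "('r, 'z) ring_scheme \<Rightarrow> ('r, 'g, 'y) module_scheme \<Rightarrow> nat \<Rightarrow> ('g list \<Rightarrow> 'r) set
    \<Rightarrow> ('r, ('g list \<Rightarrow> 'r) set) module" where
  "tuple_quot R M n E = quot_module (free_module R (tuples M n)) (tuple_rels R M n E)"

definition tuple_class ::
  "('r, 'z) ring_scheme \<Rightarrow> ('r, 'g, 'y) module_scheme \<Rightarrow> nat \<Rightarrow> ('g list \<Rightarrow> 'r) set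
    \<Rightarrow> 'g list \<Rightarrow> ('g list \<Rightarrow> 'r) set" where
  "tuple_class R M n E xs = tuple_rels R M n E +>\<^bsub>free_module R (tuples M n)\<^esub> free_gen R xs"

text \<open>
  The \<open>R\<close>-linear map to \<open>N\<close> sending the class of each tuple \<open>xs\<close> to \<open>\<phi> xs\<close>; meaningful when
  \<open>\<phi>\<close> is multilinear and compatible with the further relations.
\<close>

definition tuple_lift ::
  "('r, 'z) ring_scheme \<Rightarrow> ('r, 'n, 'y) module_scheme \<Rightarrow> ('g list \<Rightarrow> 'n)
    \<Rightarrow> ('g list \<Rightarrow> 'r) set \<Rightarrow> 'n" where
  "tuple_lift R N \<phi> = quot_induced (free_extension R N \<phi>)"

definition tensor_power ::
  "('r, 'z) ring_scheme \<Rightarrow> ('r, 'g, 'y) module_scheme \<Rightarrow> nat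
    \<Rightarrow> ('r, ('g list \<Rightarrow> 'r) set) module" where
  "tensor_power R M n = tuple_quot R M n {}"

definition alternating_rels ::
  "('r, 'z) ring_scheme \<Rightarrow> ('r, 'g, 'y) module_scheme \<Rightarrow> nat \<Rightarrow> ('g list \<Rightarrow> 'r) set" where
  "alternating_rels R M n = {free_gen R xs | xs. xs \<in> tuples M n \<and> \<not> distinct xs}"

definition exterior_power ::
  "('r, 'z) ring_scheme \<Rightarrow> ('r, 'g, 'y) module_scheme \<Rightarrow> nat
    \<Rightarrow> ('r, ('g list \<Rightarrow> 'r) set) module" where
  "exterior_power R M n = tuple_quot R M n (alternating_rels R M n)"

definition wedge ::
  "('r, 'z) ring_scheme \<Rightarrow> ('r, 'g, 'y) module_scheme \<Rightarrow> 'g list \<Rightarrow> ('g list \<Rightarrow> 'r) set" where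
  "wedge R M xs = tuple_class R M (length xs) (alternating_rels R M (length xs)) xs"

definition commuting_rels ::
  "('r, 'z) ring_scheme \<Rightarrow> ('r, 'g, 'y) module_scheme \<Rightarrow> ('g list \<Rightarrow> 'r) set" where
  "commuting_rels R M =
    {free_gen R [x, y] \<ominus>\<^bsub>free_module R (tuples M 2)\<^esub> free_gen R [y, x] | x y.
       x \<in> carrier M \<and> y \<in> carrier M}"

definition sym_square ::
  "('r, 'z) ring_scheme \<Rightarrow> ('r, 'g, 'y) module_scheme \<Rightarrow> ('r, ('g list \<Rightarrow> 'r) set) module" where
  "sym_square R M = tuple_quot R M 2 (commuting_rels R M)"

definition sym_prod ::
  "('r, 'z) ring_scheme \<Rightarrow> ('r, 'g, 'y) module_scheme \<Rightarrow> 'g \<Rightarrow> 'g \<Rightarrow> ('g list \<Rightarrow> 'r) set" where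
  "sym_prod R M x y = tuple_class R M 2 (commuting_rels R M) [x, y]"

text \<open>
  Indices of lists start at \<open>0\<close>; shifting both \<open>i\<close> and \<open>j\<close> by one does not affect the sign
  \<open>(-1)^(i+j)\<close>. For \<open>n = 0\<close> the sum below is empty, so \<open>ce_boundary R L 0\<close> is the zero map
  (with the irrelevant target \<open>exterior_power R L 0\<close>).
\<close>

definition ce_boundary ::
  "('r, 'z) ring_scheme \<Rightarrow> ('r, 'g, 'y) lie_scheme \<Rightarrow> nat
    \<Rightarrow> ('g list \<Rightarrow> 'r) set \<Rightarrow> ('g list \<Rightarrow> 'r) set" where
  "ce_boundary R L n =
    tuple_lift R (exterior_power R L (n - 1))
      (\<lambda>xs. \<Oplus>\<^bsub>exterior_power R L (n - 1)\<^esub>j\<in>{..<n}.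
         \<Oplus>\<^bsub>exterior_power R L (n - 1)\<^esub>i\<in>{..<j}.
         ((\<ominus>\<^bsub>R\<^esub> \<one>\<^bsub>R\<^esub>) [^]\<^bsub>R\<^esub> (i + j)) \<odot>\<^bsub>exterior_power R L (n - 1)\<^esub>
           wedge R L (\<lbrace>xs ! i, xs ! j\<rbrace>\<^bsub>L\<^esub> # nths xs (- {i, j})))"

definition ce_cycles ::
  "('r, 'z) ring_scheme \<Rightarrow> ('r, 'g, 'y) lie_scheme \<Rightarrow> nat \<Rightarrow> ('g list \<Rightarrow> 'r) set set" where
  "ce_cycles R L n =
    a_kernel (exterior_power R L n) (exterior_power R L (n - 1)) (ce_boundary R L n)"

definition ce_boundaries ::
  "('r, 'z) ring_scheme \<Rightarrow> ('r, 'g, 'y) lie_scheme \<Rightarrow> nat \<Rightarrow> ('g list \<Rightarrow> 'r) set set" where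
  "ce_boundaries R L n = ce_boundary R L (n + 1) ` carrier (exterior_power R L (n + 1))"

definition ce_homology ::
  "('r, 'z) ring_scheme \<Rightarrow> ('r, 'g, 'y) lie_scheme \<Rightarrow> nat
    \<Rightarrow> ('r, ('g list \<Rightarrow> 'r) set set) module" where
  "ce_homology R L n =
    quot_module ((exterior_power R L n)\<lparr>carrier := ce_cycles R L n\<rparr>) (ce_boundaries R L n)"

definition killing_rel_map ::
  "('r, 'z) ring_scheme \<Rightarrow> ('r, 'g, 'y) lie_scheme
    \<Rightarrow> ('g list \<Rightarrow> 'r) set \<Rightarrow> ('g list \<Rightarrow> 'r) set" where
  "killing_rel_map R L =
    tuple_lift R (sym_square R L)
      (\<lambda>xs. sym_prod R L \<lbrace>xs ! 0, xs ! 1\<rbrace>\<^bsub>L\<^esub> (xs ! 2)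
        \<ominus>\<^bsub>sym_square R L\<^esub> sym_prod R L (xs ! 0) \<lbrace>xs ! 1, xs ! 2\<rbrace>\<^bsub>L\<^esub>)"

definition killing_rels ::
  "('r, 'z) ring_scheme \<Rightarrow> ('r, 'g, 'y) lie_scheme \<Rightarrow> ('g list \<Rightarrow> 'r) set set" where
  "killing_rels R L = killing_rel_map R L ` carrier (tensor_power R L 3)"

definition killing_module ::
  "('r, 'z) ring_scheme \<Rightarrow> ('r, 'g, 'y) lie_scheme
    \<Rightarrow> ('r, ('g list \<Rightarrow> 'r) set set) module" where
  "killing_module R L = quot_module (sym_square R L) (killing_rels R L)"

definition koszul_map ::
  "('r, 'z) ring_scheme \<Rightarrow> ('r, 'g, 'y) lie_scheme
    \<Rightarrow> ('g list \<Rightarrow> 'r) set \<Rightarrow> ('g list \<Rightarrow> 'r) set set" where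
  "koszul_map R L =
    tuple_lift R (killing_module R L)
      (\<lambda>xs. killing_rels R L +>\<^bsub>sym_square R L\<^esub> sym_prod R L (xs ! 0) \<lbrace>xs ! 1, xs ! 2\<rbrace>\<^bsub>L\<^esub>)"

definition reduced_koszul_map ::
  "('r, 'z) ring_scheme \<Rightarrow> ('r, 'g, 'y) lie_scheme
    \<Rightarrow> ('g list \<Rightarrow> 'r) set set \<Rightarrow> ('g list \<Rightarrow> 'r) set set" where
  "reduced_koszul_map R L = quot_induced (koszul_map R L)"

end

theory Submission
  imports Defs
begin

text \<open>
  Write \<open>x\<cdot>y\<close> for the class of \<open>x\<odot>y\<close> in the Killing module, and let \<open>\<Phi> : \<Lambda>\<^sup>2 L \<rightarrow> Kill L\<close> be the
  alternating map with \<open>\<Phi>(u, v) = (m - n) / (m + n) (u\<cdot>v)\<close> for \<open>u\<close> of degree \<open>m\<close> and \<open>v\<close> of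
  degree \<open>n\<close>; it exists because the degrees are positive and the ground ring contains the rationals.
  For homogeneous \<open>x, y, z\<close> of degrees \<open>a, b, c\<close> the terms of \<open>\<Phi>(\<partial>\<^sub>3(x\<and>y\<and>z))\<close> are multiples of
  \<open>x\<cdot>[y, z]\<close>, with coefficients that have the common denominator \<open>a + b + c\<close> and add up to \<open>-1\<close>.
  Hence \<open>\<eta> = - \<Phi> \<circ> \<partial>\<^sub>3\<close>, which vanishes on cycles.
\<close>

section \<open>Linear maps and submodules\<close>

text \<open>The coefficient of \<Phi> comes from the degree derivation \<open>D\<close>, which
  multiplies degree n by n. As the product on the Killing module is symmetric and invariant,
  \<open>D u \<cdot> v - u \<cdot> D v\<close>, that is \<open>(m - n) u \<cdot> v\<close>, is
  alternating, and composed with \<open>\<partial>\<^sub>3\<close> it gives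
  \<open>-(a + b + c)\<close> times the Koszul map in degrees a, b, c. The bracket preserves total
  degree, so division by \<open>a + b + c\<close> can be done inside \<Phi>, where it becomes
  division by \<open>m + n\<close>. Most of the work is well-definedness. The maps are extensions
  from free modules on lists followed by \<open>the_elem\<close> on a coset, and they say nothing
  until they are known to respect the relations; so \<open>\<partial>\<^sub>3\<close>,
  \<open>\<partial>\<^sub>4\<close> and the Koszul map are each shown to be multilinear and
  alternating before they are evaluated on wedges. Likewise the reduced map has a definite value on
  a homology class only once the Koszul map kills boundaries; that holds in every Lie algebra, by
  invariance and the Jacobi identity.\<close>

lemma (in abelian_group) minus_zero_eq: "\<ominus> \<zero> = \<zero>"
  using r_neg[OF zero_closed] by simp

text \<open>Sorting a sum can put two terms ahead of their two negatives; then no neighbouring pair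
  cancels, and this rule closes the gap in the computations with
  \<open>\<partial>\<^sub>4\<close>.\<close>

lemma (in abelian_group) add_add_minus_minus:
  "\<lbrakk>x \<in> carrier G; y \<in> carrier G\<rbrakk> \<Longrightarrow> x \<oplus> (y \<oplus> (\<ominus> x \<oplus> \<ominus> y)) = \<zero>"
  using r_neg[of "x \<oplus> y"] by (simp add: minus_add a_assoc)

text \<open>A predicate on functions that looks only at the carriers, so that linearity in one
  variable of a compound expression is derived by composing rules for lambda terms.\<close>

definition linear_map ::
  "('r, 'z) ring_scheme \<Rightarrow> ('r, 'm, 'y) module_scheme \<Rightarrow> ('r, 'n, 'x) module_scheme \<Rightarrow> ('m \<Rightarrow> 'n) \<Rightarrow> bool"
  where "linear_map R M N h \<longleftrightarrow>
    h \<in> carrier M \<rightarrow> carrier N \<and>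
    (\<forall>x\<in>carrier M. \<forall>y\<in>carrier M. h (x \<oplus>\<^bsub>M\<^esub> y) = h x \<oplus>\<^bsub>N\<^esub> h y) \<and>
    (\<forall>a\<in>carrier R. \<forall>x\<in>carrier M. h (a \<odot>\<^bsub>M\<^esub> x) = a \<odot>\<^bsub>N\<^esub> h x)"

lemma linear_mapI:
  assumes "\<And>x. x \<in> carrier M \<Longrightarrow> h x \<in> carrier N"
    and "\<And>x y. x \<in> carrier M \<Longrightarrow> y \<in> carrier M \<Longrightarrow> h (x \<oplus>\<^bsub>M\<^esub> y) = h x \<oplus>\<^bsub>N\<^esub> h y"
    and "\<And>a x. a \<in> carrier R \<Longrightarrow> x \<in> carrier M \<Longrightarrow> h (a \<odot>\<^bsub>M\<^esub> x) = a \<odot>\<^bsub>N\<^esub> h x"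
  shows "linear_map R M N h"
  using assms by (auto simp: linear_map_def)

lemma linear_map_closed: "linear_map R M N h \<Longrightarrow> x \<in> carrier M \<Longrightarrow> h x \<in> carrier N"
  and linear_map_add: "linear_map R M N h \<Longrightarrow> x \<in> carrier M \<Longrightarrow> y \<in> carrier M \<Longrightarrow>
    h (x \<oplus>\<^bsub>M\<^esub> y) = h x \<oplus>\<^bsub>N\<^esub> h y"
  and linear_map_smult: "linear_map R M N h \<Longrightarrow> a \<in> carrier R \<Longrightarrow> x \<in> carrier M \<Longrightarrow>
    h (a \<odot>\<^bsub>M\<^esub> x) = a \<odot>\<^bsub>N\<^esub> h x"
  by (auto simp: linear_map_def)

lemma linear_map_comp:
  "linear_map R M N h \<Longrightarrow> linear_map R N P k \<Longrightarrow> linear_map R M P (\<lambda>x. k (h x))"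
  by (auto simp: linear_map_def Pi_iff)

lemma linear_map_zero:
  assumes "module R M" "module R N" "linear_map R M N h"
  shows "h \<zero>\<^bsub>M\<^esub> = \<zero>\<^bsub>N\<^esub>"
proof -
  interpret M: module R M by fact
  interpret N: module R N by fact
  have "h (\<zero>\<^bsub>R\<^esub> \<odot>\<^bsub>M\<^esub> \<zero>\<^bsub>M\<^esub>) = \<zero>\<^bsub>R\<^esub> \<odot>\<^bsub>N\<^esub> h \<zero>\<^bsub>M\<^esub>"
    using assms(3) by (intro linear_map_smult) auto
  then show ?thesis using linear_map_closed[OF assms(3)] by simp
qed

lemma linear_map_neg:
  assumes "module R M" "module R N" "linear_map R M N h" "x \<in> carrier M"
  shows "h (\<ominus>\<^bsub>M\<^esub> x) = \<ominus>\<^bsub>N\<^esub> h x"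
proof -
  interpret M: module R M by fact
  interpret N: module R N by fact
  have "h (\<ominus>\<^bsub>R\<^esub> \<one>\<^bsub>R\<^esub> \<odot>\<^bsub>M\<^esub> x) = \<ominus>\<^bsub>R\<^esub> \<one>\<^bsub>R\<^esub> \<odot>\<^bsub>N\<^esub> h x"
    using assms by (intro linear_map_smult) auto
  then show ?thesis
    using linear_map_closed[OF assms(3,4)] assms(4) by (simp add: M.smult_l_minus N.smult_l_minus)
qed

lemma linear_map_minus:
  assumes "module R M" "module R N" "linear_map R M N h" "x \<in> carrier M" "y \<in> carrier M"
  shows "h (x \<ominus>\<^bsub>M\<^esub> y) = h x \<ominus>\<^bsub>N\<^esub> h y"
proof -
  interpret M: module R M by fact
  show ?thesis using assms by (simp add: a_minus_def linear_map_add linear_map_neg)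
qed

lemma linear_map_finsum:
  assumes "module R M" "module R N" "linear_map R M N h" "f \<in> A \<rightarrow> carrier M"
  shows "h (\<Oplus>\<^bsub>M\<^esub>i\<in>A. f i) = (\<Oplus>\<^bsub>N\<^esub>i\<in>A. h (f i))"
proof -
  interpret M: module R M by fact
  interpret N: module R N by fact
  show ?thesis
  proof (cases "finite A")
    case True
    then show ?thesis using assms(4)
    proof (induction A)
      case empty
      then show ?case using linear_map_zero[OF assms(1-3)] by (simp add: M.finsum_empty N.finsum_empty)
    next
      case (insert a A)
      then show ?case
        using linear_map_closed[OF assms(3)] linear_map_add[OF assms(3)]
        by (simp add: M.finsum_insert N.finsum_insert Pi_iff)
    qed
  next
    \<comment> \<open>Over an infinite index set both sums take the default value zero, which h
      preserves.\<close>
    case False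
    then show ?thesis using linear_map_zero[OF assms(1-3)] by (simp add: M.finsum_infinite N.finsum_infinite)
  qed
qed

text \<open>The reason why linear maps that agree on generators agree everywhere. Kernels are the
  case where k is zero.\<close>

lemma submodule_equalizer:
  assumes "module R M" "module R N" "linear_map R M N h" "linear_map R M N k"
  shows "submodule {x \<in> carrier M. h x = k x} R M"
proof -
  interpret M: module R M by fact
  show ?thesis
    by (rule M.submoduleI)
      (auto simp: linear_map_zero[OF assms(1,2)] linear_map_neg[OF assms(1,2)] assms(3,4)
        linear_map_add[OF assms(3)] linear_map_add[OF assms(4)]
        linear_map_smult[OF assms(3)] linear_map_smult[OF assms(4)])
qed

lemma linear_map_plus:
  assumes "module R N" "linear_map R M N h" "linear_map R M N k"
  shows "linear_map R M N (\<lambda>x. h x \<oplus>\<^bsub>N\<^esub> k x)"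
proof -
  interpret N: module R N by fact
  show ?thesis
    using linear_map_closed[OF assms(2)] linear_map_closed[OF assms(3)]
    by (intro linear_mapI)
      (simp_all add: linear_map_add[OF assms(2)] linear_map_add[OF assms(3)] N.a_ac
        linear_map_smult[OF assms(2)] linear_map_smult[OF assms(3)] N.smult_r_distr)
qed

text \<open>Scaling commutes with scalars because R is commutative.\<close>

lemma linear_map_scale:
  assumes "module R N" "linear_map R M N h" "a \<in> carrier R"
  shows "linear_map R M N (\<lambda>x. a \<odot>\<^bsub>N\<^esub> h x)"
proof -
  interpret N: module R N by fact
  show ?thesis
    using linear_map_closed[OF assms(2)] assms(3)
    by (intro linear_mapI)
      (simp_all add: linear_map_add[OF assms(2)] linear_map_smult[OF assms(2)] N.smult_r_distr
        N.smult_assoc1[symmetric] N.R.m_comm)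
qed

lemma linear_map_uminus:
  assumes "module R N" "linear_map R M N h"
  shows "linear_map R M N (\<lambda>x. \<ominus>\<^bsub>N\<^esub> h x)"
proof -
  interpret N: module R N by fact
  show ?thesis
    using linear_map_closed[OF assms(2)]
    by (intro linear_mapI)
      (simp_all add: linear_map_add[OF assms(2)] linear_map_smult[OF assms(2)] N.smult_r_minus N.minus_add)
qed

lemma linear_map_zero_map: "module R N \<Longrightarrow> linear_map R M N (\<lambda>x. \<zero>\<^bsub>N\<^esub>)"
proof -
  assume "module R N"
  then interpret N: module R N .
  show ?thesis by (auto intro!: linear_mapI)
qed

lemma submodule_kernel:
  assumes "module R M" "module R N" "linear_map R M N h"
  shows "submodule {x \<in> carrier M. h x = \<zero>\<^bsub>N\<^esub>} R M"
  using submodule_equalizer[OF assms linear_map_zero_map[OF assms(2)]] .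

lemma submodule_image:
  assumes "module R M" "module R N" "linear_map R M N h"
  shows "submodule (h ` carrier M) R N"
proof -
  interpret M: module R M by fact
  interpret N: module R N by fact
  show ?thesis
  proof (rule N.submoduleI)
    show "h ` carrier M \<subseteq> carrier N" using linear_map_closed[OF assms(3)] by auto
    show "\<zero>\<^bsub>N\<^esub> \<in> h ` carrier M" using linear_map_zero[OF assms] by (metis M.zero_closed imageI)
    show "\<ominus>\<^bsub>N\<^esub> a \<in> h ` carrier M" if "a \<in> h ` carrier M" for a
      using that linear_map_neg[OF assms] by (metis (no_types, lifting) M.a_inv_closed image_iff)
    show "a \<oplus>\<^bsub>N\<^esub> b \<in> h ` carrier M" if "a \<in> h ` carrier M" "b \<in> h ` carrier M" for a b
      using that linear_map_add[OF assms(3)] by (metis (no_types, lifting) M.a_closed image_iff)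
    show "a \<odot>\<^bsub>N\<^esub> b \<in> h ` carrier M" if "a \<in> carrier R" "b \<in> h ` carrier M" for a b
      using that linear_map_smult[OF assms(3)] by (metis (no_types, lifting) M.smult_closed image_iff)
  qed
qed

section \<open>Generated submodules and cosets\<close>

lemma submodule_gen_subset: "S \<subseteq> submodule_gen R M S"
  by (simp add: submodule_gen_def hull_subset)

lemma submodule_gen_minimal: "S \<subseteq> H \<Longrightarrow> submodule H R M \<Longrightarrow> submodule_gen R M S \<subseteq> H"
  by (simp add: submodule_gen_def hull_minimal)

text \<open>\<open>submodule_gen\<close> is the intersection of all submodules containing S. The
  assumption on S puts the carrier into that family; over an empty family the hull would be the
  whole type.\<close>

lemma submodule_submodule_gen:
  assumes "module R M" "S \<subseteq> carrier M"
  shows "submodule (submodule_gen R M S) R M"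
proof -
  interpret M: module R M by fact
  have car: "submodule_gen R M S \<subseteq> carrier M"
    using assms(2) by (intro submodule_gen_minimal M.carrier_is_submodule)
  show ?thesis
  proof (rule M.submoduleI[OF car])
    show "\<zero>\<^bsub>M\<^esub> \<in> submodule_gen R M S"
      unfolding submodule_gen_def hull_def
      using subgroup.one_closed[OF submodule.axioms(1)] by fastforce
  qed (auto simp: submodule_gen_def hull_def dest: M.submoduleE)
qed

lemma submodule_abelian_subgroup:
  assumes "module R M" "submodule H R M"
  shows "abelian_subgroup H M"
proof -
  interpret M: module R M by fact
  show ?thesis
    using submodule.axioms(1)[OF assms(2)]
    by (intro abelian_subgroupI3 additive_subgroup.intro M.abelian_group_axioms)
qed

lemma coset_eq_iff:
  assumes "module R M" "submodule H R M" "x \<in> carrier M" "y \<in> carrier M"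
  shows "H +>\<^bsub>M\<^esub> x = H +>\<^bsub>M\<^esub> y \<longleftrightarrow> x \<ominus>\<^bsub>M\<^esub> y \<in> H"
proof -
  interpret M: module R M by fact
  interpret H: abelian_subgroup H M using assms submodule_abelian_subgroup by blast
  have "x \<in> H +>\<^bsub>M\<^esub> y \<longleftrightarrow> x \<ominus>\<^bsub>M\<^esub> y \<in> H"
    using H.a_rcos_module[OF assms(4,3)] by (simp add: a_minus_def)
  then show ?thesis
    using assms(3,4) H.a_repr_independence' H.a_repr_independenceD by metis
qed

section \<open>Quotients and free modules\<close>

lemma quot_module_simps:
  "carrier (quot_module M H) = (\<lambda>x. H +>\<^bsub>M\<^esub> x) ` carrier M"
  "add (quot_module M H) = set_add M"
  "zero (quot_module M H) = H"
  "module.smult (quot_module M H) = (\<lambda>a C. \<Union>x\<in>C. H +>\<^bsub>M\<^esub> (a \<odot>\<^bsub>M\<^esub> x))"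
  by (auto simp: quot_module_def A_RCOSETS_def')

lemma quot_module_add:
  assumes "module R M" "submodule H R M" "x \<in> carrier M" "y \<in> carrier M"
  shows "(H +>\<^bsub>M\<^esub> x) \<oplus>\<^bsub>quot_module M H\<^esub> (H +>\<^bsub>M\<^esub> y) = H +>\<^bsub>M\<^esub> (x \<oplus>\<^bsub>M\<^esub> y)"
proof -
  interpret H: abelian_subgroup H M using assms submodule_abelian_subgroup by blast
  show ?thesis using H.a_rcos_sum assms(3,4) by (simp add: quot_module_simps)
qed

text \<open>The scalar action on the quotient is a union over all representatives y of the coset.
  They differ from x by elements of H, hence so do their multiples by a, and the union is one of
  equal cosets; x itself shows that it is not an empty union.\<close>

lemma quot_module_smult:
  assumes "module R M" "submodule H R M" "a \<in> carrier R" "x \<in> carrier M"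
  shows "a \<odot>\<^bsub>quot_module M H\<^esub> (H +>\<^bsub>M\<^esub> x) = H +>\<^bsub>M\<^esub> (a \<odot>\<^bsub>M\<^esub> x)"
proof -
  interpret M: module R M by fact
  interpret H: abelian_subgroup H M using assms submodule_abelian_subgroup by blast
  have "H +>\<^bsub>M\<^esub> (a \<odot>\<^bsub>M\<^esub> y) = H +>\<^bsub>M\<^esub> (a \<odot>\<^bsub>M\<^esub> x)" if "y \<in> H +>\<^bsub>M\<^esub> x" for y
  proof -
    have y: "y \<in> carrier M" using that assms(4) H.a_elemrcos_carrier by blast
    have "y \<ominus>\<^bsub>M\<^esub> x \<in> H" using that y assms(4) H.a_rcos_module by (simp add: a_minus_def)
    then have "a \<odot>\<^bsub>M\<^esub> (y \<ominus>\<^bsub>M\<^esub> x) \<in> H" using assms(2,3) M.submoduleE(4) by blast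
    then show ?thesis
      using assms y by (simp add: coset_eq_iff[OF assms(1,2)] a_minus_def M.smult_r_distr M.smult_r_minus)
  qed
  moreover have "x \<in> H +>\<^bsub>M\<^esub> x" using assms(4) H.a_rcos_self by blast
  ultimately show ?thesis unfolding quot_module_simps by blast
qed

lemma quot_module_module:
  assumes "module R M" "submodule H R M"
  shows "module R (quot_module M H)"
proof -
  interpret M: module R M by fact
  interpret H: abelian_subgroup H M using assms submodule_abelian_subgroup by blast
  have zero: "\<zero>\<^bsub>quot_module M H\<^esub> = H +>\<^bsub>M\<^esub> \<zero>\<^bsub>M\<^esub>"
    using H.a_subset by (simp add: quot_module_simps)
  have "abelian_group (quot_module M H)"
  proof (rule abelian_groupI)
    show "\<zero>\<^bsub>quot_module M H\<^esub> \<in> carrier (quot_module M H)"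
      unfolding zero by (simp add: quot_module_simps(1))
  next
    fix U V W assume "U \<in> carrier (quot_module M H)" "V \<in> carrier (quot_module M H)"
      "W \<in> carrier (quot_module M H)"
    then obtain x y z where "x \<in> carrier M" "U = H +>\<^bsub>M\<^esub> x" "y \<in> carrier M" "V = H +>\<^bsub>M\<^esub> y"
      "z \<in> carrier M" "W = H +>\<^bsub>M\<^esub> z"
      by (auto simp: quot_module_simps)
    then show "U \<oplus>\<^bsub>quot_module M H\<^esub> V \<oplus>\<^bsub>quot_module M H\<^esub> W =
      U \<oplus>\<^bsub>quot_module M H\<^esub> (V \<oplus>\<^bsub>quot_module M H\<^esub> W)"
      by (simp add: quot_module_add[OF assms] M.a_assoc)
  next
    fix U V assume "U \<in> carrier (quot_module M H)" "V \<in> carrier (quot_module M H)"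
    then obtain x y where "x \<in> carrier M" "U = H +>\<^bsub>M\<^esub> x" "y \<in> carrier M" "V = H +>\<^bsub>M\<^esub> y"
      by (auto simp: quot_module_simps)
    then show "U \<oplus>\<^bsub>quot_module M H\<^esub> V \<in> carrier (quot_module M H)"
      and "U \<oplus>\<^bsub>quot_module M H\<^esub> V = V \<oplus>\<^bsub>quot_module M H\<^esub> U"
      by (simp_all add: quot_module_add[OF assms] quot_module_simps(1) M.a_comm)
  next
    fix U assume "U \<in> carrier (quot_module M H)"
    then obtain x where x: "x \<in> carrier M" "U = H +>\<^bsub>M\<^esub> x" by (auto simp: quot_module_simps)
    then show "\<zero>\<^bsub>quot_module M H\<^esub> \<oplus>\<^bsub>quot_module M H\<^esub> U = U"
      by (simp only: zero quot_module_add[OF assms] M.zero_closed M.l_zero)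
    have "(H +>\<^bsub>M\<^esub> (\<ominus>\<^bsub>M\<^esub> x)) \<oplus>\<^bsub>quot_module M H\<^esub> U = \<zero>\<^bsub>quot_module M H\<^esub>"
      using x by (simp only: zero quot_module_add[OF assms] M.a_inv_closed M.l_neg)
    then show "\<exists>V\<in>carrier (quot_module M H). V \<oplus>\<^bsub>quot_module M H\<^esub> U = \<zero>\<^bsub>quot_module M H\<^esub>"
      using x(1) by (intro bexI[of _ "H +>\<^bsub>M\<^esub> (\<ominus>\<^bsub>M\<^esub> x)"]) (auto simp: quot_module_simps(1))
  qed
  then show ?thesis
  proof (rule moduleI[OF M.R.is_cring])
    note [simp] = quot_module_smult[OF assms] quot_module_add[OF assms]
    fix a U assume *: "a \<in> carrier R" "U \<in> carrier (quot_module M H)"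
    then obtain x where x: "x \<in> carrier M" "U = H +>\<^bsub>M\<^esub> x"
      by (auto simp: quot_module_simps)
    show "a \<odot>\<^bsub>quot_module M H\<^esub> U \<in> carrier (quot_module M H)"
      using * x by (simp add: quot_module_simps(1))
    show "(a \<oplus>\<^bsub>R\<^esub> b) \<odot>\<^bsub>quot_module M H\<^esub> U =
      a \<odot>\<^bsub>quot_module M H\<^esub> U \<oplus>\<^bsub>quot_module M H\<^esub> b \<odot>\<^bsub>quot_module M H\<^esub> U"
      if "b \<in> carrier R" for b
      using * x that by (simp add: M.smult_l_distr)
    show "(a \<otimes>\<^bsub>R\<^esub> b) \<odot>\<^bsub>quot_module M H\<^esub> U = a \<odot>\<^bsub>quot_module M H\<^esub> (b \<odot>\<^bsub>quot_module M H\<^esub> U)"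
      if "b \<in> carrier R" for b
      using * x that by (simp add: M.smult_assoc1)
    show "a \<odot>\<^bsub>quot_module M H\<^esub> (U \<oplus>\<^bsub>quot_module M H\<^esub> V) =
      a \<odot>\<^bsub>quot_module M H\<^esub> U \<oplus>\<^bsub>quot_module M H\<^esub> a \<odot>\<^bsub>quot_module M H\<^esub> V"
      if "V \<in> carrier (quot_module M H)" for V
      using * x that by (auto simp: M.smult_r_distr quot_module_simps(1))
  next
    show "\<one>\<^bsub>R\<^esub> \<odot>\<^bsub>quot_module M H\<^esub> U = U" if "U \<in> carrier (quot_module M H)" for U
      using that by (auto simp: quot_module_smult[OF assms] quot_module_simps(1))
  qed
qed

lemma linear_map_coset:
  assumes "module R M" "submodule H R M"
  shows "linear_map R M (quot_module M H) (\<lambda>x. H +>\<^bsub>M\<^esub> x)"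
  by (rule linear_mapI)
    (simp_all add: quot_module_add[OF assms] quot_module_smult[OF assms] quot_module_simps(1))

lemma coset_eq_zero_iff:
  assumes "module R M" "submodule H R M" "x \<in> carrier M"
  shows "H +>\<^bsub>M\<^esub> x = \<zero>\<^bsub>quot_module M H\<^esub> \<longleftrightarrow> x \<in> H"
proof -
  interpret M: module R M by fact
  interpret H: abelian_subgroup H M using assms submodule_abelian_subgroup by blast
  have "H +>\<^bsub>M\<^esub> x = H +>\<^bsub>M\<^esub> \<zero>\<^bsub>M\<^esub> \<longleftrightarrow> x \<ominus>\<^bsub>M\<^esub> \<zero>\<^bsub>M\<^esub> \<in> H"
    using coset_eq_iff[OF assms(1,2)] assms(3) by auto
  moreover have "x \<ominus>\<^bsub>M\<^esub> \<zero>\<^bsub>M\<^esub> = x"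
    using assms(3) by (simp add: a_minus_def M.minus_zero_eq)
  ultimately show ?thesis using assms(3) H.a_subset by (simp add: quot_module_simps)
qed

text \<open>Since h kills H, the image of a coset is a singleton, and \<open>the_elem\<close> then
  picks its element.\<close>

lemma quot_induced_coset:
  assumes "module R M" "module R N" "submodule H R M" "linear_map R M N h"
    and "H \<subseteq> {x \<in> carrier M. h x = \<zero>\<^bsub>N\<^esub>}" "x \<in> carrier M"
  shows "quot_induced h (H +>\<^bsub>M\<^esub> x) = h x"
proof -
  interpret M: module R M by fact
  interpret N: module R N by fact
  interpret H: abelian_subgroup H M using assms submodule_abelian_subgroup by blast
  have "h y = h x" if y: "y \<in> H +>\<^bsub>M\<^esub> x" for y
  proof -
    obtain k where k: "k \<in> H" "y = k \<oplus>\<^bsub>M\<^esub> x" using y by (auto simp: a_r_coset_def')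
    then have "h k = \<zero>\<^bsub>N\<^esub>" "k \<in> carrier M" using assms(5) by auto
    then show ?thesis
      using k assms(6) linear_map_add[OF assms(4)] linear_map_closed[OF assms(4,6)] by simp
  qed
  moreover have "x \<in> H +>\<^bsub>M\<^esub> x" using assms(6) H.a_rcos_self by blast
  ultimately have "h ` (H +>\<^bsub>M\<^esub> x) = {h x}" by blast
  then show ?thesis by (simp add: quot_induced_def)
qed

lemma linear_map_quot_induced:
  assumes "module R M" "module R N" "submodule H R M" "linear_map R M N h"
    and "H \<subseteq> {x \<in> carrier M. h x = \<zero>\<^bsub>N\<^esub>}"
  shows "linear_map R (quot_module M H) N (quot_induced h)"
proof -
  interpret M: module R M by fact
  note [simp] = quot_induced_coset[OF assms]
  show ?thesis
    by (rule linear_mapI)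
      (auto simp: quot_module_simps(1) quot_module_add[OF assms(1,3)] quot_module_smult[OF assms(1,3)]
        linear_map_closed[OF assms(4)] linear_map_add[OF assms(4)] linear_map_smult[OF assms(4)])
qed

section \<open>Free modules and their universal property\<close>

lemma free_module_simps:
  "carrier (free_module R B) = {f. (\<forall>x\<in>B. f x \<in> carrier R) \<and> (\<forall>x. x \<notin> B \<longrightarrow> f x = \<zero>\<^bsub>R\<^esub>) \<and>
                   finite {x. f x \<noteq> \<zero>\<^bsub>R\<^esub>}}"
  "add (free_module R B) = (\<lambda>f g x. f x \<oplus>\<^bsub>R\<^esub> g x)"
  "zero (free_module R B) = (\<lambda>x. \<zero>\<^bsub>R\<^esub>)"
  "module.smult (free_module R B) = (\<lambda>a f x. a \<otimes>\<^bsub>R\<^esub> f x)"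
  by (auto simp: free_module_def)

text \<open>Valid for every x, because coefficients off B are zero; coefficientwise arguments then
  need no case distinction on B.\<close>

lemma free_module_coeff:
  "cring R \<Longrightarrow> f \<in> carrier (free_module R B) \<Longrightarrow> f x \<in> carrier R"
proof -
  assume "cring R"
  then interpret cring R .
  show "f \<in> carrier (free_module R B) \<Longrightarrow> f x \<in> carrier R"
    by (cases "x \<in> B") (auto simp: free_module_simps)
qed

lemma free_module_module:
  assumes "cring R"
  shows "module R (free_module R B)"
proof -
  interpret R: cring R by fact
  note C = free_module_coeff[OF assms, where B = B]
  have add: "f \<oplus>\<^bsub>free_module R B\<^esub> g \<in> carrier (free_module R B)"
    if "f \<in> carrier (free_module R B)" "g \<in> carrier (free_module R B)" for f g
  proof -
    have "{x. f x \<oplus>\<^bsub>R\<^esub> g x \<noteq> \<zero>\<^bsub>R\<^esub>} \<subseteq> {x. f x \<noteq> \<zero>\<^bsub>R\<^esub>} \<union> {x. g x \<noteq> \<zero>\<^bsub>R\<^esub>}" by auto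
    then show ?thesis using that by (auto simp: free_module_simps intro: finite_subset)
  qed
  have smult: "a \<odot>\<^bsub>free_module R B\<^esub> f \<in> carrier (free_module R B)"
    if "a \<in> carrier R" "f \<in> carrier (free_module R B)" for a f
  proof -
    have "{x. a \<otimes>\<^bsub>R\<^esub> f x \<noteq> \<zero>\<^bsub>R\<^esub>} \<subseteq> {x. f x \<noteq> \<zero>\<^bsub>R\<^esub>}" using that by auto
    then show ?thesis using that by (auto simp: free_module_simps intro: finite_subset)
  qed
  have "abelian_group (free_module R B)"
  proof (rule abelian_groupI)
    fix f assume f: "f \<in> carrier (free_module R B)"
    \<comment> \<open>The additive inverse of f is taken to be its multiple by minus one, whose
      membership in the carrier is already known from \<open>smult\<close>.\<close>
    have "(\<ominus>\<^bsub>R\<^esub> \<one>\<^bsub>R\<^esub> \<odot>\<^bsub>free_module R B\<^esub> f) \<oplus>\<^bsub>free_module R B\<^esub> f = \<zero>\<^bsub>free_module R B\<^esub>"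
      using C[OF f] by (simp add: free_module_simps R.l_minus R.l_neg)
    then show "\<exists>g\<in>carrier (free_module R B). g \<oplus>\<^bsub>free_module R B\<^esub> f = \<zero>\<^bsub>free_module R B\<^esub>"
      using smult[OF _ f] by (metis R.a_inv_closed R.one_closed)
    show "\<zero>\<^bsub>free_module R B\<^esub> \<oplus>\<^bsub>free_module R B\<^esub> f = f"
      using C[OF f] by (simp add: free_module_simps(2,3))
    fix g assume g: "g \<in> carrier (free_module R B)"
    show "f \<oplus>\<^bsub>free_module R B\<^esub> g \<in> carrier (free_module R B)" using add f g .
    show "f \<oplus>\<^bsub>free_module R B\<^esub> g = g \<oplus>\<^bsub>free_module R B\<^esub> f"
      using C[OF f] C[OF g] by (simp add: free_module_simps(2) R.a_comm)
    fix h assume h: "h \<in> carrier (free_module R B)"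
    show "f \<oplus>\<^bsub>free_module R B\<^esub> g \<oplus>\<^bsub>free_module R B\<^esub> h = f \<oplus>\<^bsub>free_module R B\<^esub> (g \<oplus>\<^bsub>free_module R B\<^esub> h)"
      using C[OF f] C[OF g] C[OF h] by (simp add: free_module_simps(2) R.a_assoc)
  qed (simp add: free_module_simps)
  then show ?thesis
  proof (rule moduleI[OF assms])
    fix f assume f: "f \<in> carrier (free_module R B)"
    show "\<one>\<^bsub>R\<^esub> \<odot>\<^bsub>free_module R B\<^esub> f = f" using C[OF f] by (simp add: free_module_simps(4))
    fix a assume a: "a \<in> carrier R"
    show "a \<odot>\<^bsub>free_module R B\<^esub> f \<in> carrier (free_module R B)" using smult a f .
    show "a \<odot>\<^bsub>free_module R B\<^esub> (f \<oplus>\<^bsub>free_module R B\<^esub> g) =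
      a \<odot>\<^bsub>free_module R B\<^esub> f \<oplus>\<^bsub>free_module R B\<^esub> a \<odot>\<^bsub>free_module R B\<^esub> g"
      if "g \<in> carrier (free_module R B)" for g
      using C[OF f] C[OF that] a by (simp add: free_module_simps(2,4) R.r_distr)
    fix b assume b: "b \<in> carrier R"
    show "(a \<oplus>\<^bsub>R\<^esub> b) \<odot>\<^bsub>free_module R B\<^esub> f =
      a \<odot>\<^bsub>free_module R B\<^esub> f \<oplus>\<^bsub>free_module R B\<^esub> b \<odot>\<^bsub>free_module R B\<^esub> f"
      using C[OF f] a b by (simp add: free_module_simps(2,4) R.l_distr)
    show "(a \<otimes>\<^bsub>R\<^esub> b) \<odot>\<^bsub>free_module R B\<^esub> f = a \<odot>\<^bsub>free_module R B\<^esub> (b \<odot>\<^bsub>free_module R B\<^esub> f)"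
      using C[OF f] a b by (simp add: free_module_simps(4) R.m_assoc)
  qed
qed

lemma free_gen_carrier [simp, intro]: "cring R \<Longrightarrow> x \<in> B \<Longrightarrow> free_gen R x \<in> carrier (free_module R B)"
proof -
  assume "cring R" "x \<in> B"
  then interpret cring R by simp
  show ?thesis using \<open>x \<in> B\<close>
    by (auto simp: free_module_simps free_gen_def intro: finite_subset[of _ "{x}"])
qed

lemma free_module_span:
  assumes "cring R" and H: "submodule H R (free_module R B)" "free_gen R ` B \<subseteq> H"
  shows "carrier (free_module R B) \<subseteq> H"
proof
  interpret R: cring R by fact
  interpret F: module R "free_module R B" using assms by (intro free_module_module)
  fix f assume f: "f \<in> carrier (free_module R B)"
  \<comment> \<open>The induction runs over a finite set containing the support: clearing the
    coefficient at a leaves a function supported in the smaller set, and f is that function plus a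
    multiple of one generator.\<close>
  have "f \<in> H" if "finite A" "{x. f x \<noteq> \<zero>\<^bsub>R\<^esub>} \<subseteq> A" "A \<subseteq> B" "\<forall>x. f x \<in> carrier R" for A f
    using that
  proof (induction A arbitrary: f)
    case empty
    then have "f = \<zero>\<^bsub>free_module R B\<^esub>" by (auto simp: free_module_simps)
    then show ?case using H(1) subgroup.one_closed[OF submodule.axioms(1)] by fastforce
  next
    case (insert a A)
    have "f (a := \<zero>\<^bsub>R\<^esub>) \<in> H" by (rule insert.IH) (use insert.prems in auto)
    moreover have "f a \<odot>\<^bsub>free_module R B\<^esub> free_gen R a \<in> H"
      using insert.prems H F.submoduleE(4) by blast
    ultimately have "f (a := \<zero>\<^bsub>R\<^esub>) \<oplus>\<^bsub>free_module R B\<^esub> f a \<odot>\<^bsub>free_module R B\<^esub> free_gen R a \<in> H"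
      using H F.submoduleE(5) by blast
    also have "f (a := \<zero>\<^bsub>R\<^esub>) \<oplus>\<^bsub>free_module R B\<^esub> f a \<odot>\<^bsub>free_module R B\<^esub> free_gen R a = f"
      using insert.prems by (auto simp: free_module_simps free_gen_def fun_eq_iff)
    finally show ?case .
  qed
  moreover have "finite {x. f x \<noteq> \<zero>\<^bsub>R\<^esub>}" "{x. f x \<noteq> \<zero>\<^bsub>R\<^esub>} \<subseteq> B"
    using f by (auto simp: free_module_simps)
  ultimately show "f \<in> H"
    using free_module_coeff[OF assms(1) f] by blast
qed

lemma linear_maps_eq_on_free_module:
  assumes "cring R" "module R N" "linear_map R (free_module R B) N h" "linear_map R (free_module R B) N k"
    and "\<And>b. b \<in> B \<Longrightarrow> h (free_gen R b) = k (free_gen R b)" "f \<in> carrier (free_module R B)"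
  shows "h f = k f"
proof -
  have "free_gen R ` B \<subseteq> {f \<in> carrier (free_module R B). h f = k f}"
    using assms(1,5) by blast
  then show ?thesis
    using free_module_span[OF assms(1) submodule_equalizer[OF free_module_module[OF assms(1)] assms(2-4)]]
      assms(6) by blast
qed

text \<open>The defining sum runs over the support, which varies with f. To compare different
  elements one sums over a common finite set; the additional terms are zero.\<close>

lemma free_extension_superset:
  assumes "module R N" "\<phi> \<in> B \<rightarrow> carrier N" "f \<in> carrier (free_module R B)"
    and "finite A" "{x. f x \<noteq> \<zero>\<^bsub>R\<^esub>} \<subseteq> A" "A \<subseteq> B"
  shows "free_extension R N \<phi> f = (\<Oplus>\<^bsub>N\<^esub>x\<in>A. f x \<odot>\<^bsub>N\<^esub> \<phi> x)"
proof -
  interpret N: module R N by fact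
  have \<phi>: "\<phi> x \<in> carrier N" if "x \<in> A" for x
    using that assms(2,6) by blast
  show ?thesis
    unfolding free_extension_def
  proof (rule N.add.finprod_mono_neutral_cong_left[OF assms(4,5)])
    show "f x \<odot>\<^bsub>N\<^esub> \<phi> x = \<zero>\<^bsub>N\<^esub>" if "x \<in> A - {x. f x \<noteq> \<zero>\<^bsub>R\<^esub>}" for x
      using that \<phi> by simp
    show "(\<lambda>x. f x \<odot>\<^bsub>N\<^esub> \<phi> x) \<in> A \<rightarrow> carrier N"
      using \<phi> free_module_coeff[OF N.R.is_cring assms(3)] by simp
  qed simp
qed

lemma free_extension_gen:
  assumes "module R N" "\<phi> \<in> B \<rightarrow> carrier N" "b \<in> B"
  shows "free_extension R N \<phi> (free_gen R b) = \<phi> b"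
proof -
  interpret N: module R N by fact
  have "\<phi> b \<in> carrier N" using assms by auto
  moreover have "{x. free_gen R b x \<noteq> \<zero>\<^bsub>R\<^esub>} \<subseteq> {b}" by (auto simp: free_gen_def)
  ultimately show ?thesis
    using free_extension_superset[OF assms(1,2) free_gen_carrier[OF N.R.is_cring assms(3)], of "{b}"] assms(3)
    by (simp add: free_gen_def N.finsum_insert N.finsum_empty)
qed

lemma linear_map_free_extension:
  assumes "module R N" "\<phi> \<in> B \<rightarrow> carrier N"
  shows "linear_map R (free_module R B) N (free_extension R N \<phi>)"
proof -
  interpret N: module R N by fact
  interpret F: module R "free_module R B" by (intro free_module_module N.R.is_cring)
  note C = free_module_coeff[OF N.R.is_cring, where B = B]
  show ?thesis
  proof (rule linear_mapI)
    fix f assume f: "f \<in> carrier (free_module R B)"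
    have \<phi>: "\<phi> x \<in> carrier N" if "x \<in> B" for x using assms(2) that by blast
    have *: "{x. f x \<noteq> \<zero>\<^bsub>R\<^esub>} \<subseteq> B" using f by (auto simp: free_module_simps)
    have \<phi>supp: "\<phi> x \<in> carrier N" if "f x \<noteq> \<zero>\<^bsub>R\<^esub>" for x using \<phi> * that by blast
    show "free_extension R N \<phi> f \<in> carrier N"
      unfolding free_extension_def using f * assms(2) C[OF f]
      by (intro N.add.finprod_closed) auto
    have fin: "finite {x. f x \<noteq> \<zero>\<^bsub>R\<^esub>}" using f by (simp add: free_module_simps)
    {
      fix g assume g: "g \<in> carrier (free_module R B)"
      define A where "A = {x. f x \<noteq> \<zero>\<^bsub>R\<^esub>} \<union> {x. g x \<noteq> \<zero>\<^bsub>R\<^esub>}"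
      have A: "finite A" "A \<subseteq> B" using f g by (auto simp: A_def free_module_simps)
      have S: "f \<oplus>\<^bsub>free_module R B\<^esub> g \<in> carrier (free_module R B)" using f g by simp
      have sub: "{x. (f \<oplus>\<^bsub>free_module R B\<^esub> g) x \<noteq> \<zero>\<^bsub>R\<^esub>} \<subseteq> A" by (auto simp: free_module_simps A_def)
      have "free_extension R N \<phi> (f \<oplus>\<^bsub>free_module R B\<^esub> g) =
          (\<Oplus>\<^bsub>N\<^esub>x\<in>A. f x \<odot>\<^bsub>N\<^esub> \<phi> x \<oplus>\<^bsub>N\<^esub> g x \<odot>\<^bsub>N\<^esub> \<phi> x)"
        unfolding free_extension_superset[OF assms S A(1) sub A(2)]
        using \<phi> A(2) C[OF f] C[OF g]
        by (intro N.add.finprod_cong') (simp_all add: free_module_simps(2) N.smult_l_distr subset_iff)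
      also have "\<dots> = (\<Oplus>\<^bsub>N\<^esub>x\<in>A. f x \<odot>\<^bsub>N\<^esub> \<phi> x) \<oplus>\<^bsub>N\<^esub> (\<Oplus>\<^bsub>N\<^esub>x\<in>A. g x \<odot>\<^bsub>N\<^esub> \<phi> x)"
        using assms(2) A C[OF f] C[OF g] by (intro N.finsum_addf) (auto simp: Pi_iff subset_iff)
      also have "\<dots> = free_extension R N \<phi> f \<oplus>\<^bsub>N\<^esub> free_extension R N \<phi> g"
        by (subst (1 2) free_extension_superset[OF assms, of _ A]) (use f g A in \<open>auto simp: A_def\<close>)
      finally show "free_extension R N \<phi> (f \<oplus>\<^bsub>free_module R B\<^esub> g) =
        free_extension R N \<phi> f \<oplus>\<^bsub>N\<^esub> free_extension R N \<phi> g" .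
    }
    {
      fix a assume a: "a \<in> carrier R"
      have S: "a \<odot>\<^bsub>free_module R B\<^esub> f \<in> carrier (free_module R B)" using a f by simp
      have sub: "{x. (a \<odot>\<^bsub>free_module R B\<^esub> f) x \<noteq> \<zero>\<^bsub>R\<^esub>} \<subseteq> {x. f x \<noteq> \<zero>\<^bsub>R\<^esub>}"
        using a by (auto simp: free_module_simps)
      have "free_extension R N \<phi> (a \<odot>\<^bsub>free_module R B\<^esub> f) =
          (\<Oplus>\<^bsub>N\<^esub>x\<in>{x. f x \<noteq> \<zero>\<^bsub>R\<^esub>}. a \<odot>\<^bsub>N\<^esub> (f x \<odot>\<^bsub>N\<^esub> \<phi> x))"
        unfolding free_extension_superset[OF assms S fin sub *]
        using \<phi>supp C[OF f] a
        by (intro N.add.finprod_cong') (simp_all add: free_module_simps(4) N.smult_assoc1)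
      also have "\<dots> = a \<odot>\<^bsub>N\<^esub> (\<Oplus>\<^bsub>N\<^esub>x\<in>{x. f x \<noteq> \<zero>\<^bsub>R\<^esub>}. f x \<odot>\<^bsub>N\<^esub> \<phi> x)"
        using \<phi>supp C[OF f] a fin
        by (intro N.finsum_smult_ldistr[symmetric]) simp_all
      finally show "free_extension R N \<phi> (a \<odot>\<^bsub>free_module R B\<^esub> f) = a \<odot>\<^bsub>N\<^esub> free_extension R N \<phi> f"
        by (simp add: free_extension_def)
    }
  qed
qed

section \<open>Multilinear maps and quotients of tuple spaces\<close>

text \<open>Slots are varied by list update, which is the shape of the relations in
  \<open>multilinear_rels\<close>.\<close>

definition multilinear ::
  "('r, 'z) ring_scheme \<Rightarrow> ('r, 'g, 'y) module_scheme \<Rightarrow> ('r, 'n, 'x) module_scheme \<Rightarrow> nat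
    \<Rightarrow> ('g list \<Rightarrow> 'n) \<Rightarrow> bool"
  where "multilinear R M N n \<phi> \<longleftrightarrow>
    \<phi> \<in> tuples M n \<rightarrow> carrier N \<and>
    (\<forall>xs\<in>tuples M n. \<forall>i<n. linear_map R M N (\<lambda>x. \<phi> (xs[i := x])))"

lemma multilinear_closed: "multilinear R M N n \<phi> \<Longrightarrow> xs \<in> tuples M n \<Longrightarrow> \<phi> xs \<in> carrier N"
  by (auto simp: multilinear_def)

lemma multilinear_linear:
  "multilinear R M N n \<phi> \<Longrightarrow> xs \<in> tuples M n \<Longrightarrow> i < n \<Longrightarrow> linear_map R M N (\<lambda>x. \<phi> (xs[i := x]))"
  by (auto simp: multilinear_def)

lemma tuples_conv:
  "xs \<in> tuples M 2 \<longleftrightarrow> (\<exists>a b. xs = [a, b] \<and> a \<in> carrier M \<and> b \<in> carrier M)"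
  "xs \<in> tuples M 3 \<longleftrightarrow> (\<exists>a b c. xs = [a, b, c] \<and> a \<in> carrier M \<and> b \<in> carrier M \<and> c \<in> carrier M)"
  "xs \<in> tuples M 4 \<longleftrightarrow> (\<exists>a b c d. xs = [a, b, c, d] \<and> a \<in> carrier M \<and> b \<in> carrier M \<and>
     c \<in> carrier M \<and> d \<in> carrier M)"
  by (auto simp: tuples_def length_Suc_conv numeral_eq_Suc)

context module
begin

abbreviation "tuple_space n \<equiv> free_module R (tuples M n)"

lemma tuple_update: "xs \<in> tuples M n \<Longrightarrow> x \<in> carrier M \<Longrightarrow> xs[i := x] \<in> tuples M n"
  using set_update_subset_insert[of xs i x] by (auto simp: tuples_def)

lemma tuple_space_module: "module R (tuple_space n)"
  by (rule free_module_module[OF R.is_cring])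

lemma multilinear_rels_carrier: "multilinear_rels R M n \<subseteq> carrier (tuple_space n)"
proof -
  interpret F: module R "tuple_space n" by (rule tuple_space_module)
  show ?thesis
    unfolding multilinear_rels_def Let_def
    by (auto intro!: F.minus_closed F.a_closed F.smult_closed free_gen_carrier R.is_cring tuple_update)
qed

lemma tuple_rels_submodule:
  "E \<subseteq> carrier (tuple_space n) \<Longrightarrow> submodule (tuple_rels R M n E) R (tuple_space n)"
  unfolding tuple_rels_def
  using multilinear_rels_carrier by (intro submodule_submodule_gen tuple_space_module) auto

lemma tuple_quot_module:
  "E \<subseteq> carrier (tuple_space n) \<Longrightarrow> module R (tuple_quot R M n E)"
  unfolding tuple_quot_def by (intro quot_module_module tuple_space_module tuple_rels_submodule)

text \<open>The kernel of the free extension is a submodule. It contains the multilinearity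
  relations because \<phi> is multilinear, and E by assumption, so it contains the submodule they
  generate.\<close>

lemma tuple_rels_kernel:
  assumes N: "module R N" and \<phi>: "multilinear R M N n \<phi>"
    and E: "E \<subseteq> carrier (tuple_space n)" "\<And>f. f \<in> E \<Longrightarrow> free_extension R N \<phi> f = \<zero>\<^bsub>N\<^esub>"
  shows "tuple_rels R M n E \<subseteq> {f \<in> carrier (tuple_space n). free_extension R N \<phi> f = \<zero>\<^bsub>N\<^esub>}"
proof -
  interpret N: module R N by fact
  interpret F: module R "tuple_space n" by (rule tuple_space_module)
  have \<phi>c: "\<phi> \<in> tuples M n \<rightarrow> carrier N" using \<phi> by (simp add: multilinear_def)
  note lin = linear_map_free_extension[OF N \<phi>c]
  note gen = free_extension_gen[OF N \<phi>c] free_gen_carrier[OF R.is_cring] tuple_update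
  note hom = linear_map_minus[OF F.module_axioms N lin] linear_map_add[OF lin] linear_map_smult[OF lin]
  have "multilinear_rels R M n \<subseteq> {f \<in> carrier (tuple_space n). free_extension R N \<phi> f = \<zero>\<^bsub>N\<^esub>}"
  proof
    fix f assume f: "f \<in> multilinear_rels R M n"
    then consider
      xs i x y where "xs \<in> tuples M n" "i < n" "x \<in> carrier M" "y \<in> carrier M"
        "f = free_gen R (xs[i := x \<oplus>\<^bsub>M\<^esub> y]) \<ominus>\<^bsub>tuple_space n\<^esub>
           (free_gen R (xs[i := x]) \<oplus>\<^bsub>tuple_space n\<^esub> free_gen R (xs[i := y]))"
      | xs i a x where "xs \<in> tuples M n" "i < n" "a \<in> carrier R" "x \<in> carrier M"
        "f = free_gen R (xs[i := a \<odot>\<^bsub>M\<^esub> x]) \<ominus>\<^bsub>tuple_space n\<^esub>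
           a \<odot>\<^bsub>tuple_space n\<^esub> free_gen R (xs[i := x])"
      unfolding multilinear_rels_def Let_def by blast
    then have "free_extension R N \<phi> f = \<zero>\<^bsub>N\<^esub>"
    proof cases
      case 1
      have "free_extension R N \<phi> f = \<phi> (xs[i := x \<oplus>\<^bsub>M\<^esub> y]) \<ominus>\<^bsub>N\<^esub> (\<phi> (xs[i := x]) \<oplus>\<^bsub>N\<^esub> \<phi> (xs[i := y]))"
        using 1 by (simp add: hom gen)
      also have "\<dots> = \<zero>\<^bsub>N\<^esub>"
        using 1 multilinear_closed[OF \<phi>] linear_map_add[OF multilinear_linear[OF \<phi> 1(1,2)] 1(3,4)]
        by (simp add: a_minus_def N.r_neg tuple_update)
      finally show ?thesis .
    next
      case 2
      have "free_extension R N \<phi> f = \<phi> (xs[i := a \<odot>\<^bsub>M\<^esub> x]) \<ominus>\<^bsub>N\<^esub> a \<odot>\<^bsub>N\<^esub> \<phi> (xs[i := x])"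
        using 2 by (simp add: hom gen)
      also have "\<dots> = \<zero>\<^bsub>N\<^esub>"
        using 2 multilinear_closed[OF \<phi>] linear_map_smult[OF multilinear_linear[OF \<phi> 2(1,2)] 2(3,4)]
        by (simp add: a_minus_def N.r_neg tuple_update)
      finally show ?thesis .
    qed
    then show "f \<in> {f \<in> carrier (tuple_space n). free_extension R N \<phi> f = \<zero>\<^bsub>N\<^esub>}"
      using f multilinear_rels_carrier by blast
  qed
  then show ?thesis
    unfolding tuple_rels_def
    using E by (intro submodule_gen_minimal submodule_kernel[OF F.module_axioms N lin]) auto
qed

text \<open>With \<open>tuple_lift_class\<close>, this is the universal property of the tuple
  quotients. The tensor power, the exterior power and the symmetric square arise from different
  choices of E.\<close>

lemma linear_map_tuple_lift:
  assumes "module R N" "multilinear R M N n \<phi>"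
    and "E \<subseteq> carrier (tuple_space n)" "\<And>f. f \<in> E \<Longrightarrow> free_extension R N \<phi> f = \<zero>\<^bsub>N\<^esub>"
  shows "linear_map R (tuple_quot R M n E) N (tuple_lift R N \<phi>)"
proof -
  have "\<phi> \<in> tuples M n \<rightarrow> carrier N" using assms(2) by (simp add: multilinear_def)
  then show ?thesis
    unfolding tuple_quot_def tuple_lift_def
    by (intro linear_map_quot_induced tuple_space_module tuple_rels_submodule
        linear_map_free_extension tuple_rels_kernel assms)
qed

lemma tuple_lift_class:
  assumes "module R N" "multilinear R M N n \<phi>"
    and "E \<subseteq> carrier (tuple_space n)" "\<And>f. f \<in> E \<Longrightarrow> free_extension R N \<phi> f = \<zero>\<^bsub>N\<^esub>"
    and "xs \<in> tuples M n"
  shows "tuple_lift R N \<phi> (tuple_class R M n E xs) = \<phi> xs"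
proof -
  have \<phi>c: "\<phi> \<in> tuples M n \<rightarrow> carrier N" using assms(2) by (simp add: multilinear_def)
  show ?thesis
    unfolding tuple_lift_def tuple_class_def
    using quot_induced_coset[OF tuple_space_module assms(1) tuple_rels_submodule[OF assms(3)]
        linear_map_free_extension[OF assms(1) \<phi>c] tuple_rels_kernel[OF assms(1-4)]
        free_gen_carrier[OF R.is_cring assms(5)]]
      free_extension_gen[OF assms(1) \<phi>c assms(5)]
    by simp
qed

lemma tuple_class_zero:
  assumes "E \<subseteq> carrier (tuple_space n)" "free_gen R xs \<in> E"
  shows "tuple_class R M n E xs = \<zero>\<^bsub>tuple_quot R M n E\<^esub>"
proof -
  have "free_gen R xs \<in> tuple_rels R M n E"
    unfolding tuple_rels_def by (rule subsetD[OF submodule_gen_subset]) (simp add: assms(2))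
  then show ?thesis
    using coset_eq_zero_iff[OF tuple_space_module tuple_rels_submodule[OF assms(1)], of "free_gen R xs"]
      assms by (auto simp: tuple_class_def tuple_quot_def)
qed

text \<open>Each generating relation is a difference of two elements of the free module, and
  \<open>coset_eq_iff\<close> turns its membership into the required equation between
  classes.\<close>

lemma multilinear_tuple_class:
  assumes E: "E \<subseteq> carrier (tuple_space n)"
  shows "multilinear R M (tuple_quot R M n E) n (tuple_class R M n E)"
proof -
  interpret F: module R "tuple_space n" by (rule tuple_space_module)
  note sub = tuple_rels_submodule[OF E]
  note rel = coset_eq_iff[OF F.module_axioms sub]
  have gen: "free_gen R xs \<in> carrier (tuple_space n)" if "xs \<in> tuples M n" for xs
    using that R.is_cring by simp
  have mem: "f \<in> tuple_rels R M n E" if "f \<in> multilinear_rels R M n" for f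
    unfolding tuple_rels_def by (rule subsetD[OF submodule_gen_subset]) (simp add: that)
  have "tuple_class R M n E (xs[i := x \<oplus>\<^bsub>M\<^esub> y]) =
      tuple_class R M n E (xs[i := x]) \<oplus>\<^bsub>tuple_quot R M n E\<^esub> tuple_class R M n E (xs[i := y])"
    if *: "xs \<in> tuples M n" "i < n" "x \<in> carrier M" "y \<in> carrier M" for xs i x y
  proof -
    have "free_gen R (xs[i := x \<oplus>\<^bsub>M\<^esub> y]) \<ominus>\<^bsub>tuple_space n\<^esub>
       (free_gen R (xs[i := x]) \<oplus>\<^bsub>tuple_space n\<^esub> free_gen R (xs[i := y])) \<in> tuple_rels R M n E"
      by (rule mem) (use * in \<open>auto simp: multilinear_rels_def Let_def\<close>)
    then show ?thesis
      unfolding tuple_class_def tuple_quot_def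
      using * by (simp add: quot_module_add[OF F.module_axioms sub] rel gen tuple_update)
  qed
  moreover have "tuple_class R M n E (xs[i := a \<odot>\<^bsub>M\<^esub> x]) =
      a \<odot>\<^bsub>tuple_quot R M n E\<^esub> tuple_class R M n E (xs[i := x])"
    if *: "xs \<in> tuples M n" "i < n" "a \<in> carrier R" "x \<in> carrier M" for xs i a x
  proof -
    have "free_gen R (xs[i := a \<odot>\<^bsub>M\<^esub> x]) \<ominus>\<^bsub>tuple_space n\<^esub>
       a \<odot>\<^bsub>tuple_space n\<^esub> free_gen R (xs[i := x]) \<in> tuple_rels R M n E"
      by (rule mem) (use * in \<open>auto simp: multilinear_rels_def Let_def\<close>)
    then show ?thesis
      unfolding tuple_class_def tuple_quot_def
      using * by (simp add: quot_module_smult[OF F.module_axioms sub] rel gen tuple_update)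
  qed
  moreover have "tuple_class R M n E \<in> tuples M n \<rightarrow> carrier (tuple_quot R M n E)"
    using gen by (auto simp: tuple_class_def tuple_quot_def quot_module_simps(1))
  ultimately show ?thesis
    unfolding multilinear_def by (auto intro!: linear_mapI tuple_update)
qed

text \<open>Composing with the projection from the free module reduces the claim to the generators,
  whose cosets are the tuple classes.\<close>

lemma linear_maps_eq_on_tuple_quot:
  assumes N: "module R N" and E: "E \<subseteq> carrier (tuple_space n)"
    and h: "linear_map R (tuple_quot R M n E) N h" and k: "linear_map R (tuple_quot R M n E) N k"
    and eq: "\<And>xs. xs \<in> tuples M n \<Longrightarrow> h (tuple_class R M n E xs) = k (tuple_class R M n E xs)"
    and u: "u \<in> carrier (tuple_quot R M n E)"
  shows "h u = k u"
proof -
  note q = linear_map_coset[OF tuple_space_module tuple_rels_submodule[OF E], folded tuple_quot_def]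
  obtain f where f: "f \<in> carrier (tuple_space n)" "u = tuple_rels R M n E +>\<^bsub>tuple_space n\<^esub> f"
    using u by (auto simp: tuple_quot_def quot_module_simps(1))
  then show ?thesis
    using linear_maps_eq_on_free_module[OF R.is_cring N linear_map_comp[OF q h] linear_map_comp[OF q k]]
      eq by (simp add: tuple_class_def)
qed

section \<open>Multilinearity in two, three and four variables\<close>

lemma multilinear2I:
  assumes "\<And>b. b \<in> carrier M \<Longrightarrow> linear_map R M N (\<lambda>x. \<phi> [x, b])"
    and "\<And>a. a \<in> carrier M \<Longrightarrow> linear_map R M N (\<lambda>x. \<phi> [a, x])"
  shows "multilinear R M N 2 \<phi>"
  using assms linear_map_closed[OF assms(1)] unfolding multilinear_def
  by (auto simp: tuples_conv less_2_cases_iff)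

lemma multilinear3I:
  assumes "\<And>b c. b \<in> carrier M \<Longrightarrow> c \<in> carrier M \<Longrightarrow> linear_map R M N (\<lambda>x. \<phi> [x, b, c])"
    and "\<And>a c. a \<in> carrier M \<Longrightarrow> c \<in> carrier M \<Longrightarrow> linear_map R M N (\<lambda>x. \<phi> [a, x, c])"
    and "\<And>a b. a \<in> carrier M \<Longrightarrow> b \<in> carrier M \<Longrightarrow> linear_map R M N (\<lambda>x. \<phi> [a, b, x])"
  shows "multilinear R M N 3 \<phi>"
proof -
  have "i < 3 \<longleftrightarrow> i = 0 \<or> i = 1 \<or> i = 2" for i :: nat by auto
  then show ?thesis
    using assms linear_map_closed[OF assms(1)] unfolding multilinear_def
    by (auto simp: tuples_conv)
qed

lemma multilinear4I:
  assumes "\<And>b c d. b \<in> carrier M \<Longrightarrow> c \<in> carrier M \<Longrightarrow> d \<in> carrier M \<Longrightarrow>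
      linear_map R M N (\<lambda>x. \<phi> [x, b, c, d])"
    and "\<And>a c d. a \<in> carrier M \<Longrightarrow> c \<in> carrier M \<Longrightarrow> d \<in> carrier M \<Longrightarrow>
      linear_map R M N (\<lambda>x. \<phi> [a, x, c, d])"
    and "\<And>a b d. a \<in> carrier M \<Longrightarrow> b \<in> carrier M \<Longrightarrow> d \<in> carrier M \<Longrightarrow>
      linear_map R M N (\<lambda>x. \<phi> [a, b, x, d])"
    and "\<And>a b c. a \<in> carrier M \<Longrightarrow> b \<in> carrier M \<Longrightarrow> c \<in> carrier M \<Longrightarrow>
      linear_map R M N (\<lambda>x. \<phi> [a, b, c, x])"
  shows "multilinear R M N 4 \<phi>"
proof -
  have "i < 4 \<longleftrightarrow> i = 0 \<or> i = 1 \<or> i = 2 \<or> i = 3" for i :: nat by auto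
  then show ?thesis
    using assms linear_map_closed[OF assms(1)] unfolding multilinear_def
    by (auto simp: tuples_conv)
qed

lemma multilinear2D:
  assumes "multilinear R M N 2 \<phi>" "a \<in> carrier M"
  shows "linear_map R M N (\<lambda>x. \<phi> [x, a])" "linear_map R M N (\<lambda>x. \<phi> [a, x])"
  \<comment> \<open>The entry in the varying slot is overwritten, so the second a only fills the
    list to length 2.\<close>
  using multilinear_linear[OF assms(1), of "[a, a]" 0] multilinear_linear[OF assms(1), of "[a, a]" 1] assms(2)
  by (simp_all add: tuples_conv)

lemma multilinear3D:
  assumes "multilinear R M N 3 \<phi>" "a \<in> carrier M" "b \<in> carrier M"
  shows "linear_map R M N (\<lambda>x. \<phi> [x, a, b])" "linear_map R M N (\<lambda>x. \<phi> [a, x, b])"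
    "linear_map R M N (\<lambda>x. \<phi> [a, b, x])"
  using multilinear_linear[OF assms(1), of "[a, a, b]" 0] multilinear_linear[OF assms(1), of "[a, a, b]" 1]
    multilinear_linear[OF assms(1), of "[a, b, b]" 2] assms(2,3)
  by (simp_all add: tuples_conv)

end

section \<open>Exterior powers and symmetric squares\<close>

lemma linear_map_cong:
  assumes "module R M" "\<And>x. x \<in> carrier M \<Longrightarrow> h x = k x"
  shows "linear_map R M N h \<longleftrightarrow> linear_map R M N k"
proof -
  interpret M: module R M by fact
  show ?thesis using assms(2) by (simp add: linear_map_def Pi_iff)
qed

text \<open>Polarization: expand h at the pair with both entries equal to the sum of a and b. It
  serves both for the bracket and for two slots of a wedge.\<close>

lemma alternating_swap:
  assumes N: "module R N" and "module R M"
    and l: "\<And>b. b \<in> carrier M \<Longrightarrow> linear_map R M N (\<lambda>x. h x b)"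
    and r: "\<And>a. a \<in> carrier M \<Longrightarrow> linear_map R M N (\<lambda>x. h a x)"
    and z: "\<And>x. x \<in> carrier M \<Longrightarrow> h x x = \<zero>\<^bsub>N\<^esub>"
    and ab: "a \<in> carrier M" "b \<in> carrier M"
  shows "h b a = \<ominus>\<^bsub>N\<^esub> h a b"
proof -
  interpret N: module R N by fact
  interpret M: module R M by fact
  have c: "h x y \<in> carrier N" if "x \<in> carrier M" "y \<in> carrier M" for x y
    using linear_map_closed[OF l] that by simp
  have "\<zero>\<^bsub>N\<^esub> = h (a \<oplus>\<^bsub>M\<^esub> b) (a \<oplus>\<^bsub>M\<^esub> b)" using ab z by simp
  also have "\<dots> = (h a a \<oplus>\<^bsub>N\<^esub> h b a) \<oplus>\<^bsub>N\<^esub> (h a b \<oplus>\<^bsub>N\<^esub> h b b)"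
    using ab by (simp add: linear_map_add[OF l] linear_map_add[OF r])
  also have "\<dots> = h b a \<oplus>\<^bsub>N\<^esub> h a b" using ab z c by simp
  finally show ?thesis using ab c N.minus_equality by simp
qed

context module
begin

text \<open>Explicit formulas for \<open>wedge\<close> and \<open>ce_sum\<close> hold only on tuples
  of the right length over the carrier; this carries multilinearity over from such a
  formula.\<close>

lemma multilinear_cong:
  assumes "\<And>xs. xs \<in> tuples M n \<Longrightarrow> \<phi> xs = \<psi> xs"
  shows "multilinear R M N n \<phi> \<longleftrightarrow> multilinear R M N n \<psi>"
proof -
  have "linear_map R M N (\<lambda>x. \<phi> (xs[i := x])) \<longleftrightarrow> linear_map R M N (\<lambda>x. \<psi> (xs[i := x]))"
    if "xs \<in> tuples M n" for xs i
    using that assms by (intro linear_map_cong module_axioms) (simp add: tuple_update)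
  then show ?thesis using assms by (simp add: multilinear_def Pi_iff)
qed

lemma alternating_rels_carrier: "alternating_rels R M n \<subseteq> carrier (tuple_space n)"
  by (auto simp: alternating_rels_def R.is_cring)

lemma exterior_power_module: "module R (exterior_power R M n)"
  unfolding exterior_power_def by (intro tuple_quot_module alternating_rels_carrier)

lemma wedge_eq: "xs \<in> tuples M n \<Longrightarrow> wedge R M xs = tuple_class R M n (alternating_rels R M n) xs"
  by (auto simp: wedge_def tuples_def)

lemma multilinear_wedge: "multilinear R M (exterior_power R M n) n (wedge R M)"
  unfolding exterior_power_def
  by (subst multilinear_cong[of n _ "tuple_class R M n (alternating_rels R M n)"])
    (simp_all add: wedge_eq multilinear_tuple_class alternating_rels_carrier)

lemma wedge_closed: "xs \<in> tuples M n \<Longrightarrow> wedge R M xs \<in> carrier (exterior_power R M n)"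
  by (rule multilinear_closed[OF multilinear_wedge])

lemma wedge_not_distinct:
  assumes "xs \<in> tuples M n" "\<not> distinct xs"
  shows "wedge R M xs = \<zero>\<^bsub>exterior_power R M n\<^esub>"
proof -
  have "free_gen R xs \<in> alternating_rels R M n" using assms by (auto simp: alternating_rels_def)
  then show ?thesis
    using tuple_class_zero[OF alternating_rels_carrier, of xs n] wedge_eq[OF assms(1)]
    by (simp add: exterior_power_def)
qed

text \<open>The alternating relations are the generators on lists with a repetition anywhere, so
  vanishing must be checked for every pair of positions and not only for neighbours. This is the
  source of the case distinctions below.\<close>

lemma exterior_lift:
  assumes N: "module R N" and \<phi>: "multilinear R M N n \<phi>"
    and alt: "\<And>xs. xs \<in> tuples M n \<Longrightarrow> \<not> distinct xs \<Longrightarrow> \<phi> xs = \<zero>\<^bsub>N\<^esub>"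
  shows "linear_map R (exterior_power R M n) N (tuple_lift R N \<phi>)"
    and "xs \<in> tuples M n \<Longrightarrow> tuple_lift R N \<phi> (wedge R M xs) = \<phi> xs"
proof -
  have \<phi>c: "\<phi> \<in> tuples M n \<rightarrow> carrier N" using \<phi> by (simp add: multilinear_def)
  have *: "free_extension R N \<phi> f = \<zero>\<^bsub>N\<^esub>" if "f \<in> alternating_rels R M n" for f
    using that alt free_extension_gen[OF N \<phi>c] by (auto simp: alternating_rels_def)
  show "linear_map R (exterior_power R M n) N (tuple_lift R N \<phi>)"
    unfolding exterior_power_def using linear_map_tuple_lift[OF N \<phi> alternating_rels_carrier *] .
  show "tuple_lift R N \<phi> (wedge R M xs) = \<phi> xs" if "xs \<in> tuples M n"
    using tuple_lift_class[OF N \<phi> alternating_rels_carrier * that] wedge_eq[OF that] by simp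
qed

lemma linear_maps_eq_on_exterior_power:
  assumes N: "module R N" and h: "linear_map R (exterior_power R M n) N h"
    and k: "linear_map R (exterior_power R M n) N k"
    and eq: "\<And>xs. xs \<in> tuples M n \<Longrightarrow> h (wedge R M xs) = k (wedge R M xs)"
    and u: "u \<in> carrier (exterior_power R M n)"
  shows "h u = k u"
  by (rule linear_maps_eq_on_tuple_quot[OF N alternating_rels_carrier h[unfolded exterior_power_def]
      k[unfolded exterior_power_def] _ u[unfolded exterior_power_def]])
    (simp add: eq flip: wedge_eq)

section \<open>The symmetric square\<close>

lemma commuting_rels_carrier: "commuting_rels R M \<subseteq> carrier (tuple_space 2)"
proof -
  interpret F: module R "tuple_space 2" by (rule tuple_space_module)
  show ?thesis
    unfolding commuting_rels_def
    by (auto intro!: F.minus_closed free_gen_carrier R.is_cring simp: tuples_conv)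
qed

lemma sym_square_module: "module R (sym_square R M)"
  unfolding sym_square_def by (intro tuple_quot_module commuting_rels_carrier)

lemma linear_map_sym_prod:
  assumes "a \<in> carrier M"
  shows "linear_map R M (sym_square R M) (\<lambda>x. sym_prod R M x a)"
    "linear_map R M (sym_square R M) (sym_prod R M a)"
  using multilinear2D[OF multilinear_tuple_class[OF commuting_rels_carrier] assms]
  by (simp_all add: sym_square_def sym_prod_def[abs_def])

lemma sym_prod_commute:
  assumes "x \<in> carrier M" "y \<in> carrier M"
  shows "sym_prod R M x y = sym_prod R M y x"
proof -
  have "free_gen R [x, y] \<ominus>\<^bsub>tuple_space 2\<^esub> free_gen R [y, x] \<in> tuple_rels R M 2 (commuting_rels R M)"
    unfolding tuple_rels_def
    by (rule subsetD[OF submodule_gen_subset]) (use assms in \<open>auto simp: commuting_rels_def\<close>)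
  then show ?thesis
    using coset_eq_iff[OF tuple_space_module tuple_rels_submodule[OF commuting_rels_carrier]] assms
    by (simp add: sym_prod_def tuple_class_def R.is_cring tuples_conv)
qed

end

lemma lessThan_numerals: "{..<3::nat} = {0, 1, 2}" "{..<4::nat} = {0, 1, 2, 3}" "{..<2::nat} = {0, 1}"
  by auto

section \<open>Wedges of brackets and the Chevalley-Eilenberg sum on lists\<close>

context lie_algebra
begin

abbreviation ext where "ext \<equiv> exterior_power R L"

abbreviation w where "w \<equiv> wedge R L"

lemma linear_map_bracket:
  assumes "a \<in> carrier L"
  shows "linear_map R L L (\<lambda>x. \<lbrace>x, a\<rbrace>)" "linear_map R L L (\<lambda>x. \<lbrace>a, x\<rbrace>)"
  using assms
  by (auto intro!: linear_mapI simp: bracket_closed bracket_add_l bracket_add_r bracket_smult_l bracket_smult_r)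

lemma bracket_swap: "x \<in> carrier L \<Longrightarrow> y \<in> carrier L \<Longrightarrow> \<lbrace>y, x\<rbrace> = \<ominus>\<^bsub>L\<^esub> \<lbrace>x, y\<rbrace>"
  by (rule alternating_swap[OF module_axioms module_axioms]) (auto simp: linear_map_bracket bracket_self)

lemma linear_map_wedge2:
  assumes "a \<in> carrier L"
  shows "linear_map R L (ext 2) (\<lambda>x. w [x, a])" "linear_map R L (ext 2) (\<lambda>x. w [a, x])"
  using multilinear2D[OF multilinear_wedge assms] by auto

lemma linear_map_wedge3:
  assumes "a \<in> carrier L" "b \<in> carrier L"
  shows "linear_map R L (ext 3) (\<lambda>x. w [x, a, b])" "linear_map R L (ext 3) (\<lambda>x. w [a, x, b])"
    "linear_map R L (ext 3) (\<lambda>x. w [a, b, x])"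
  using multilinear3D[OF multilinear_wedge assms] by auto

lemma linear_map_wedge_bracket:
  assumes "a \<in> carrier L" "b \<in> carrier L"
  shows "linear_map R L (ext 2) (\<lambda>x. w [\<lbrace>x, a\<rbrace>, b])" "linear_map R L (ext 2) (\<lambda>x. w [\<lbrace>a, x\<rbrace>, b])"
    and "c \<in> carrier L \<Longrightarrow> linear_map R L (ext 3) (\<lambda>x. w [\<lbrace>x, a\<rbrace>, b, c])"
      "c \<in> carrier L \<Longrightarrow> linear_map R L (ext 3) (\<lambda>x. w [\<lbrace>a, x\<rbrace>, b, c])"
  using linear_map_comp[OF linear_map_bracket(1) linear_map_wedge2(1)]
    linear_map_comp[OF linear_map_bracket(2) linear_map_wedge2(1)]
    linear_map_comp[OF linear_map_bracket(1) linear_map_wedge3(1)]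
    linear_map_comp[OF linear_map_bracket(2) linear_map_wedge3(1)]
    assms by auto

text \<open>For i < j < 4 the exponents i + j range over 1 to 5.\<close>

lemma sign_powers:
  "(\<ominus>\<^bsub>R\<^esub> \<one>\<^bsub>R\<^esub>) [^]\<^bsub>R\<^esub> Suc 0 = \<ominus>\<^bsub>R\<^esub> \<one>\<^bsub>R\<^esub>"
  "(\<ominus>\<^bsub>R\<^esub> \<one>\<^bsub>R\<^esub>) [^]\<^bsub>R\<^esub> (2::nat) = \<one>\<^bsub>R\<^esub>"
  "(\<ominus>\<^bsub>R\<^esub> \<one>\<^bsub>R\<^esub>) [^]\<^bsub>R\<^esub> (3::nat) = \<ominus>\<^bsub>R\<^esub> \<one>\<^bsub>R\<^esub>"
  "(\<ominus>\<^bsub>R\<^esub> \<one>\<^bsub>R\<^esub>) [^]\<^bsub>R\<^esub> (4::nat) = \<one>\<^bsub>R\<^esub>"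
  "(\<ominus>\<^bsub>R\<^esub> \<one>\<^bsub>R\<^esub>) [^]\<^bsub>R\<^esub> (5::nat) = \<ominus>\<^bsub>R\<^esub> \<one>\<^bsub>R\<^esub>"
  by (simp_all add: numeral_eq_Suc R.l_minus R.r_minus)

text \<open>The function on lists that \<open>ce_boundary\<close> lifts, separated from the lift so
  that its multilinearity and alternation can be established first.\<close>

definition ce_sum where
  "ce_sum n xs = (\<Oplus>\<^bsub>ext (n - 1)\<^esub>j\<in>{..<n}. \<Oplus>\<^bsub>ext (n - 1)\<^esub>i\<in>{..<j}.
      ((\<ominus>\<^bsub>R\<^esub> \<one>\<^bsub>R\<^esub>) [^]\<^bsub>R\<^esub> (i + j)) \<odot>\<^bsub>ext (n - 1)\<^esub> w (\<lbrace>xs ! i, xs ! j\<rbrace> # nths xs (- {i, j})))"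

lemma ce_boundary_eq: "ce_boundary R L n = tuple_lift R (ext (n - 1)) (ce_sum n)"
  by (simp add: ce_boundary_def ce_sum_def[abs_def])

text \<open>The summands are grouped by the outer index j and then ordered by i, as the nested sums
  unfold; the same holds for \<open>ce_sum_4\<close>.\<close>

lemma ce_sum_3:
  assumes "a \<in> carrier L" "b \<in> carrier L" "c \<in> carrier L"
  shows "ce_sum 3 [a, b, c] = \<ominus>\<^bsub>ext 2\<^esub> w [\<lbrace>a, b\<rbrace>, c] \<oplus>\<^bsub>ext 2\<^esub> (w [\<lbrace>a, c\<rbrace>, b] \<oplus>\<^bsub>ext 2\<^esub> \<ominus>\<^bsub>ext 2\<^esub> w [\<lbrace>b, c\<rbrace>, a])"
proof -
  interpret E: module R "ext 2" by (rule exterior_power_module)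
  have [simp]: "w [u, v] \<in> carrier (ext 2)" if "u \<in> carrier L" "v \<in> carrier L" for u v
    using that by (intro wedge_closed) (simp add: tuples_conv)
  show ?thesis
    using assms
    by (simp add: ce_sum_def lessThan_numerals lessThan_Suc E.finsum_insert E.finsum_empty nths_Cons bracket_closed
        sign_powers E.smult_l_minus R.l_minus R.r_minus)
qed

lemma ce_sum_4:
  assumes "a \<in> carrier L" "b \<in> carrier L" "c \<in> carrier L" "d \<in> carrier L"
  shows "ce_sum 4 [a, b, c, d] = \<ominus>\<^bsub>ext 3\<^esub> w [\<lbrace>a, b\<rbrace>, c, d] \<oplus>\<^bsub>ext 3\<^esub>
    ((w [\<lbrace>a, c\<rbrace>, b, d] \<oplus>\<^bsub>ext 3\<^esub> \<ominus>\<^bsub>ext 3\<^esub> w [\<lbrace>b, c\<rbrace>, a, d]) \<oplus>\<^bsub>ext 3\<^esub>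
    (\<ominus>\<^bsub>ext 3\<^esub> w [\<lbrace>a, d\<rbrace>, b, c] \<oplus>\<^bsub>ext 3\<^esub> (w [\<lbrace>b, d\<rbrace>, a, c] \<oplus>\<^bsub>ext 3\<^esub> \<ominus>\<^bsub>ext 3\<^esub> w [\<lbrace>c, d\<rbrace>, a, b])))"
proof -
  interpret E: module R "ext 3" by (rule exterior_power_module)
  have [simp]: "w [u, v, t] \<in> carrier (ext 3)" if "u \<in> carrier L" "v \<in> carrier L" "t \<in> carrier L" for u v t
    using that by (intro wedge_closed) (simp add: tuples_conv)
  show ?thesis
    using assms
    by (simp add: ce_sum_def lessThan_numerals lessThan_Suc E.finsum_insert E.finsum_empty nths_Cons bracket_closed
        sign_powers E.smult_l_minus R.l_minus R.r_minus)
qed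

end

section \<open>The Killing module, the Koszul map and the boundary maps\<close>

context lie_algebra
begin

abbreviation Kill where "Kill \<equiv> killing_module R L"

abbreviation S2 where "S2 \<equiv> sym_square R L"

definition killing_prod where
  "killing_prod x y = killing_rels R L +>\<^bsub>S2\<^esub> sym_prod R L x y"

lemma sym_prod_closed: "x \<in> carrier L \<Longrightarrow> y \<in> carrier L \<Longrightarrow> sym_prod R L x y \<in> carrier S2"
  using linear_map_closed[OF linear_map_sym_prod(1)] .

text \<open>Linearity makes the image \<open>killing_rels\<close> a submodule, so that the cokernel
  is a module. The tensor power has no relations beyond multilinearity, so nothing else is to be
  checked.\<close>

lemma linear_map_killing_rel_map:
    "linear_map R (tensor_power R L 3) S2 (killing_rel_map R L)"
  and killing_rel_map_class:
    "xs \<in> tuples L 3 \<Longrightarrow> killing_rel_map R L (tuple_class R L 3 {} xs) =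
      sym_prod R L \<lbrace>xs ! 0, xs ! 1\<rbrace> (xs ! 2) \<ominus>\<^bsub>S2\<^esub> sym_prod R L (xs ! 0) \<lbrace>xs ! 1, xs ! 2\<rbrace>"
proof -
  let ?\<phi> = "\<lambda>xs. sym_prod R L \<lbrace>xs ! 0, xs ! 1\<rbrace> (xs ! 2) \<ominus>\<^bsub>S2\<^esub> sym_prod R L (xs ! 0) \<lbrace>xs ! 1, xs ! 2\<rbrace>"
  have "multilinear R L S2 3 ?\<phi>"
    by (rule multilinear3I; simp add: a_minus_def;
        intro linear_map_plus linear_map_uminus sym_square_module linear_map_sym_prod
          linear_map_comp[OF linear_map_bracket(1) linear_map_sym_prod(1)]
          linear_map_comp[OF linear_map_bracket(2) linear_map_sym_prod(1)]
          linear_map_comp[OF linear_map_bracket(1) linear_map_sym_prod(2)]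
          linear_map_comp[OF linear_map_bracket(2) linear_map_sym_prod(2)] bracket_closed; assumption)
  from linear_map_tuple_lift[OF sym_square_module this, of "{}"]
    tuple_lift_class[OF sym_square_module this, of "{}"]
  show "linear_map R (tensor_power R L 3) S2 (killing_rel_map R L)"
    "xs \<in> tuples L 3 \<Longrightarrow> killing_rel_map R L (tuple_class R L 3 {} xs) = ?\<phi> xs"
    by (simp_all add: tensor_power_def killing_rel_map_def)
qed

lemma killing_rels_submodule: "submodule (killing_rels R L) R S2"
  unfolding killing_rels_def
  by (rule submodule_image[OF _ sym_square_module linear_map_killing_rel_map])
    (simp add: tensor_power_def tuple_quot_module)

lemma killing_module_module: "module R Kill"
  unfolding killing_module_def by (intro quot_module_module sym_square_module killing_rels_submodule)

lemma linear_map_killing_prod: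
  assumes "a \<in> carrier L"
  shows "linear_map R L Kill (\<lambda>x. killing_prod x a)" "linear_map R L Kill (killing_prod a)"
  unfolding killing_prod_def[abs_def] killing_module_def
  by (intro linear_map_comp[OF linear_map_sym_prod(1)] linear_map_comp[OF linear_map_sym_prod(2)]
      linear_map_coset sym_square_module killing_rels_submodule assms)+

lemma killing_prod_closed: "x \<in> carrier L \<Longrightarrow> y \<in> carrier L \<Longrightarrow> killing_prod x y \<in> carrier Kill"
  using linear_map_closed[OF linear_map_killing_prod(1)] .

lemma killing_prod_commute: "x \<in> carrier L \<Longrightarrow> y \<in> carrier L \<Longrightarrow> killing_prod x y = killing_prod y x"
  by (simp add: killing_prod_def sym_prod_commute)

text \<open>Invariance of the product, as for the Killing form: the difference of the two symmetric
  products is the image of the tensor of x, y and z, hence a relation.\<close>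

lemma killing_prod_bracket:
  assumes "x \<in> carrier L" "y \<in> carrier L" "z \<in> carrier L"
  shows "killing_prod \<lbrace>x, y\<rbrace> z = killing_prod x \<lbrace>y, z\<rbrace>"
proof -
  have xs: "[x, y, z] \<in> tuples L 3" using assms by (simp add: tuples_conv)
  have "tuple_class R L 3 {} [x, y, z] \<in> carrier (tensor_power R L 3)"
    unfolding tensor_power_def using multilinear_closed[OF multilinear_tuple_class xs] by simp
  then have "sym_prod R L \<lbrace>x, y\<rbrace> z \<ominus>\<^bsub>S2\<^esub> sym_prod R L x \<lbrace>y, z\<rbrace> \<in> killing_rels R L"
    using killing_rel_map_class[OF xs] unfolding killing_rels_def by (intro image_eqI) simp_all
  then show ?thesis
    unfolding killing_prod_def using assms
    by (subst coset_eq_iff[OF sym_square_module killing_rels_submodule])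
      (auto intro!: sym_prod_closed bracket_closed)
qed

lemma linear_map_killing_prod_bracket:
  assumes "a \<in> carrier L" "b \<in> carrier L"
  shows "linear_map R L Kill (\<lambda>x. killing_prod a \<lbrace>x, b\<rbrace>)" "linear_map R L Kill (\<lambda>x. killing_prod a \<lbrace>b, x\<rbrace>)"
  using assms
  using linear_map_comp[OF linear_map_bracket(1) linear_map_killing_prod(2)]
    linear_map_comp[OF linear_map_bracket(2) linear_map_killing_prod(2)] by blast+

lemma killing_prod_zero: "x \<in> carrier L \<Longrightarrow> killing_prod x \<zero>\<^bsub>L\<^esub> = \<zero>\<^bsub>Kill\<^esub>"
  using linear_map_zero[OF module_axioms killing_module_module linear_map_killing_prod(2)] .

text \<open>Alternation comes from moving the bracket onto the equal entries:
  \<open>a \<cdot> [a, c] = [a, a] \<cdot> c\<close> and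
  \<open>a \<cdot> [b, a] = [b, a] \<cdot> a = b \<cdot> [a, a]\<close> by invariance and symmetry,
  while \<open>a \<cdot> [b, b]\<close> is zero outright.\<close>

lemma linear_map_koszul_map: "linear_map R (ext 3) Kill (koszul_map R L)"
  and koszul_map_wedge: "\<lbrakk>x \<in> carrier L; y \<in> carrier L; z \<in> carrier L\<rbrakk> \<Longrightarrow>
    koszul_map R L (w [x, y, z]) = killing_prod x \<lbrace>y, z\<rbrace>"
proof -
  let ?\<phi> = "\<lambda>xs. killing_prod (xs ! 0) \<lbrace>xs ! 1, xs ! 2\<rbrace>"
  have ml: "multilinear R L Kill 3 ?\<phi>"
    by (rule multilinear3I; simp;
        intro linear_map_killing_prod(1) linear_map_killing_prod_bracket bracket_closed; assumption)
  have alt: "?\<phi> xs = \<zero>\<^bsub>Kill\<^esub>" if "xs \<in> tuples L 3" "\<not> distinct xs" for xs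
  proof -
    obtain a b c where xs: "xs = [a, b, c]" "a \<in> carrier L" "b \<in> carrier L" "c \<in> carrier L"
      using \<open>xs \<in> tuples L 3\<close> by (auto simp: tuples_conv)
    then consider "a = b" | "a = c" | "b = c" using \<open>\<not> distinct xs\<close> by auto
    then show ?thesis
    proof cases
      case 1
      then show ?thesis
        using xs killing_prod_bracket[of a a c] killing_prod_commute[of "\<zero>\<^bsub>L\<^esub>" c]
        by (simp add: bracket_self killing_prod_zero)
    next
      case 2
      then show ?thesis
        using xs killing_prod_commute[of a "\<lbrace>b, a\<rbrace>"] killing_prod_bracket[of b a a]
        by (simp add: bracket_self killing_prod_zero bracket_closed)
    next
      case 3
      then show ?thesis using xs by (simp add: bracket_self killing_prod_zero)
    qed
  qed
  have "koszul_map R L = tuple_lift R Kill ?\<phi>"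
    by (simp add: koszul_map_def killing_prod_def)
  with exterior_lift[OF killing_module_module ml alt]
  show "linear_map R (ext 3) Kill (koszul_map R L)"
    "\<lbrakk>x \<in> carrier L; y \<in> carrier L; z \<in> carrier L\<rbrakk> \<Longrightarrow>
      koszul_map R L (w [x, y, z]) = killing_prod x \<lbrace>y, z\<rbrace>"
    by (simp_all add: tuples_conv)
qed

text \<open>Multilinearity is read off the explicit formula. If two entries coincide, their bracket
  vanishes and the other two terms cancel; only equal outer entries require antisymmetry of the
  bracket for this.\<close>

lemma linear_map_ce_boundary_3: "linear_map R (ext 3) (ext 2) (ce_boundary R L 3)"
  and ce_boundary_3_wedge: "\<lbrakk>a \<in> carrier L; b \<in> carrier L; c \<in> carrier L\<rbrakk> \<Longrightarrow>
    ce_boundary R L 3 (w [a, b, c]) =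
      \<ominus>\<^bsub>ext 2\<^esub> w [\<lbrace>a, b\<rbrace>, c] \<oplus>\<^bsub>ext 2\<^esub> (w [\<lbrace>a, c\<rbrace>, b] \<oplus>\<^bsub>ext 2\<^esub> \<ominus>\<^bsub>ext 2\<^esub> w [\<lbrace>b, c\<rbrace>, a])"
proof -
  interpret E: module R "ext 2" by (rule exterior_power_module)
  let ?\<psi> = "\<lambda>xs. \<ominus>\<^bsub>ext 2\<^esub> w [\<lbrace>xs ! 0, xs ! 1\<rbrace>, xs ! 2] \<oplus>\<^bsub>ext 2\<^esub>
    (w [\<lbrace>xs ! 0, xs ! 2\<rbrace>, xs ! 1] \<oplus>\<^bsub>ext 2\<^esub> \<ominus>\<^bsub>ext 2\<^esub> w [\<lbrace>xs ! 1, xs ! 2\<rbrace>, xs ! 0])"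
  have "multilinear R L (ext 2) 3 ?\<psi>"
    by (rule multilinear3I; simp;
        intro linear_map_plus linear_map_uminus linear_map_wedge2 linear_map_wedge_bracket exterior_power_module bracket_closed;
        assumption)
  then have ml: "multilinear R L (ext 2) 3 (ce_sum 3)"
    by (subst multilinear_cong[of 3 _ ?\<psi>]) (auto simp: tuples_conv ce_sum_3)
  have wc: "w [u, v] \<in> carrier (ext 2)" if "u \<in> carrier L" "v \<in> carrier L" for u v
    using that by (intro wedge_closed) (simp add: tuples_conv)
  have wm: "w [\<ominus>\<^bsub>L\<^esub> u, v] = \<ominus>\<^bsub>ext 2\<^esub> w [u, v]" if "u \<in> carrier L" "v \<in> carrier L" for u v
    using linear_map_neg[OF module_axioms exterior_power_module linear_map_wedge2(1)] that by blast
  have w0: "w [\<zero>\<^bsub>L\<^esub>, v] = \<zero>\<^bsub>ext 2\<^esub>" if "v \<in> carrier L" for v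
    using linear_map_zero[OF module_axioms exterior_power_module linear_map_wedge2(1)] that by blast
  have alt: "ce_sum 3 xs = \<zero>\<^bsub>ext 2\<^esub>" if "xs \<in> tuples L 3" "\<not> distinct xs" for xs
  proof -
    obtain a b c where xs: "xs = [a, b, c]" and c: "a \<in> carrier L" "b \<in> carrier L" "c \<in> carrier L"
      using \<open>xs \<in> tuples L 3\<close> by (auto simp: tuples_conv)
    then consider "a = b" | "a = c" | "b = c" using \<open>\<not> distinct xs\<close> by auto
    then show ?thesis
      unfolding xs ce_sum_3[OF c]
      by cases
        (use c bracket_swap[of a b] in \<open>simp_all add: bracket_self bracket_closed wc w0 wm
          E.r_neg E.l_neg E.r_neg1 E.r_neg2 E.minus_zero_eq\<close>)
  qed
  have "ce_boundary R L 3 = tuple_lift R (ext 2) (ce_sum 3)"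
    by (simp add: ce_boundary_eq)
  with exterior_lift[OF exterior_power_module ml alt] ce_sum_3
  show "linear_map R (ext 3) (ext 2) (ce_boundary R L 3)"
    "\<lbrakk>a \<in> carrier L; b \<in> carrier L; c \<in> carrier L\<rbrakk> \<Longrightarrow>
      ce_boundary R L 3 (w [a, b, c]) =
        \<ominus>\<^bsub>ext 2\<^esub> w [\<lbrace>a, b\<rbrace>, c] \<oplus>\<^bsub>ext 2\<^esub> (w [\<lbrace>a, c\<rbrace>, b] \<oplus>\<^bsub>ext 2\<^esub> \<ominus>\<^bsub>ext 2\<^esub> w [\<lbrace>b, c\<rbrace>, a])"
    by (simp_all add: tuples_conv)
qed

text \<open>If two entries coincide, the term with their bracket vanishes, and the term with the
  bracket of the other two has a repeated vector in its last slots. The remaining four terms cancel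
  in pairs, up to antisymmetry of the bracket (\<open>bracket_swap\<close>) and of the last two
  slots (\<open>ws\<close>).\<close>

lemma linear_map_ce_boundary_4: "linear_map R (ext 4) (ext 3) (ce_boundary R L 4)"
  and ce_boundary_4_wedge: "\<lbrakk>a \<in> carrier L; b \<in> carrier L; c \<in> carrier L; d \<in> carrier L\<rbrakk> \<Longrightarrow>
    ce_boundary R L 4 (w [a, b, c, d]) = \<ominus>\<^bsub>ext 3\<^esub> w [\<lbrace>a, b\<rbrace>, c, d] \<oplus>\<^bsub>ext 3\<^esub>
      ((w [\<lbrace>a, c\<rbrace>, b, d] \<oplus>\<^bsub>ext 3\<^esub> \<ominus>\<^bsub>ext 3\<^esub> w [\<lbrace>b, c\<rbrace>, a, d]) \<oplus>\<^bsub>ext 3\<^esub>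
      (\<ominus>\<^bsub>ext 3\<^esub> w [\<lbrace>a, d\<rbrace>, b, c] \<oplus>\<^bsub>ext 3\<^esub> (w [\<lbrace>b, d\<rbrace>, a, c] \<oplus>\<^bsub>ext 3\<^esub> \<ominus>\<^bsub>ext 3\<^esub> w [\<lbrace>c, d\<rbrace>, a, b])))"
proof -
  interpret E: module R "ext 3" by (rule exterior_power_module)
  let ?\<psi> = "\<lambda>xs. \<ominus>\<^bsub>ext 3\<^esub> w [\<lbrace>xs ! 0, xs ! 1\<rbrace>, xs ! 2, xs ! 3] \<oplus>\<^bsub>ext 3\<^esub> 
    ((w [\<lbrace>xs ! 0, xs ! 2\<rbrace>, xs ! 1, xs ! 3] \<oplus>\<^bsub>ext 3\<^esub> \<ominus>\<^bsub>ext 3\<^esub> w [\<lbrace>xs ! 1, xs ! 2\<rbrace>, xs ! 0, xs ! 3]) \<oplus>\<^bsub>ext 3\<^esub> 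
    (\<ominus>\<^bsub>ext 3\<^esub> w [\<lbrace>xs ! 0, xs ! 3\<rbrace>, xs ! 1, xs ! 2] \<oplus>\<^bsub>ext 3\<^esub> (w [\<lbrace>xs ! 1, xs ! 3\<rbrace>, xs ! 0, xs ! 2] \<oplus>\<^bsub>ext 3\<^esub> \<ominus>\<^bsub>ext 3\<^esub> w [\<lbrace>xs ! 2, xs ! 3\<rbrace>, xs ! 0, xs ! 1])))"
  have "multilinear R L (ext 3) 4 ?\<psi>"
    by (rule multilinear4I; simp;
        intro linear_map_plus linear_map_uminus linear_map_wedge3 linear_map_wedge_bracket exterior_power_module bracket_closed;
        assumption)
  then have ml: "multilinear R L (ext 3) 4 (ce_sum 4)"
    by (subst multilinear_cong[of 4 _ ?\<psi>]) (auto simp: tuples_conv ce_sum_4)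
  have wc: "w [u, v, t] \<in> carrier (ext 3)" if "u \<in> carrier L" "v \<in> carrier L" "t \<in> carrier L" for u v t
    using that by (intro wedge_closed) (simp add: tuples_conv)
  have wm: "w [\<ominus>\<^bsub>L\<^esub> u, v, t] = \<ominus>\<^bsub>ext 3\<^esub> w [u, v, t]"
    if "u \<in> carrier L" "v \<in> carrier L" "t \<in> carrier L" for u v t
    using linear_map_neg[OF module_axioms exterior_power_module linear_map_wedge3(1)] that by blast
  have w0: "w [\<zero>\<^bsub>L\<^esub>, v, t] = \<zero>\<^bsub>ext 3\<^esub>" if "v \<in> carrier L" "t \<in> carrier L" for v t
    using linear_map_zero[OF module_axioms exterior_power_module linear_map_wedge3(1)] that by blast
  have wz: "w [u, v, v] = \<zero>\<^bsub>ext 3\<^esub>" if "u \<in> carrier L" "v \<in> carrier L" for u v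
    using that by (intro wedge_not_distinct) (auto simp: tuples_conv)
  have ws: "w [u, t, v] = \<ominus>\<^bsub>ext 3\<^esub> w [u, v, t]"
    if "u \<in> carrier L" "v \<in> carrier L" "t \<in> carrier L" for u v t
    by (rule alternating_swap[where h = "\<lambda>v t. w [u, v, t]", OF exterior_power_module module_axioms])
      (simp_all add: linear_map_wedge3 wz that)
  have alt: "ce_sum 4 xs = \<zero>\<^bsub>ext 3\<^esub>" if "xs \<in> tuples L 4" "\<not> distinct xs" for xs
  proof -
    obtain a b c d where xs: "xs = [a, b, c, d]"
      and c: "a \<in> carrier L" "b \<in> carrier L" "c \<in> carrier L" "d \<in> carrier L"
      using \<open>xs \<in> tuples L 4\<close> by (auto simp: tuples_conv)
    then consider "a = b" | "a = c" | "a = d" | "b = c" | "b = d" | "c = d"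
      using \<open>\<not> distinct xs\<close> by auto
    then show ?thesis
    proof cases
      case 1
      then show ?thesis
        unfolding xs ce_sum_4[OF c] using c 
        by (simp add: bracket_self bracket_closed wc w0 wz wm E.a_ac E.r_neg E.l_neg E.r_neg1 E.r_neg2 E.minus_zero_eq
          E.add_add_minus_minus)
    next
      case 2
      then show ?thesis
        unfolding xs ce_sum_4[OF c] using c bracket_swap[of a b] ws[of "\<lbrace>a, d\<rbrace>" a b]
        by (simp add: bracket_self bracket_closed wc w0 wz wm E.a_ac E.r_neg E.l_neg E.r_neg1 E.r_neg2 E.minus_zero_eq
          E.add_add_minus_minus)
    next
      case 3
      then show ?thesis
        unfolding xs ce_sum_4[OF c] using c bracket_swap[of a b] bracket_swap[of a c] ws[of "\<lbrace>a, b\<rbrace>" a c] ws[of "\<lbrace>a, c\<rbrace>" a b]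
        by (simp add: bracket_self bracket_closed wc w0 wz wm E.a_ac E.r_neg E.l_neg E.r_neg1 E.r_neg2 E.minus_zero_eq
          E.add_add_minus_minus)
    next
      case 4
      then show ?thesis
        unfolding xs ce_sum_4[OF c] using c 
        by (simp add: bracket_self bracket_closed wc w0 wz wm E.a_ac E.r_neg E.l_neg E.r_neg1 E.r_neg2 E.minus_zero_eq
          E.add_add_minus_minus)
    next
      case 5
      then show ?thesis
        unfolding xs ce_sum_4[OF c] using c bracket_swap[of b c] ws[of "\<lbrace>a, b\<rbrace>" b c]
        by (simp add: bracket_self bracket_closed wc w0 wz wm E.a_ac E.r_neg E.l_neg E.r_neg1 E.r_neg2 E.minus_zero_eq
          E.add_add_minus_minus)
    next
      case 6
      then show ?thesis
        unfolding xs ce_sum_4[OF c] using c 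
        by (simp add: bracket_self bracket_closed wc w0 wz wm E.a_ac E.r_neg E.l_neg E.r_neg1 E.r_neg2 E.minus_zero_eq
          E.add_add_minus_minus)
    qed
  qed
  have "ce_boundary R L 4 = tuple_lift R (ext 3) (ce_sum 4)"
    by (simp add: ce_boundary_eq)
  with exterior_lift[OF exterior_power_module ml alt] ce_sum_4
  show "linear_map R (ext 4) (ext 3) (ce_boundary R L 4)"
    "\<lbrakk>a \<in> carrier L; b \<in> carrier L; c \<in> carrier L; d \<in> carrier L\<rbrakk> \<Longrightarrow>
    ce_boundary R L 4 (w [a, b, c, d]) = \<ominus>\<^bsub>ext 3\<^esub> w [\<lbrace>a, b\<rbrace>, c, d] \<oplus>\<^bsub>ext 3\<^esub>
      ((w [\<lbrace>a, c\<rbrace>, b, d] \<oplus>\<^bsub>ext 3\<^esub> \<ominus>\<^bsub>ext 3\<^esub> w [\<lbrace>b, c\<rbrace>, a, d]) \<oplus>\<^bsub>ext 3\<^esub>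
      (\<ominus>\<^bsub>ext 3\<^esub> w [\<lbrace>a, d\<rbrace>, b, c] \<oplus>\<^bsub>ext 3\<^esub> (w [\<lbrace>b, d\<rbrace>, a, c] \<oplus>\<^bsub>ext 3\<^esub> \<ominus>\<^bsub>ext 3\<^esub> w [\<lbrace>c, d\<rbrace>, a, b])))"
    by (simp_all add: tuples_conv)
qed

end

section \<open>Direct sums\<close>

lemma linear_map_sum:
  assumes "module R N" "finite A" "\<And>i. i \<in> A \<Longrightarrow> linear_map R M N (h i)"
  shows "linear_map R M N (\<lambda>x. \<Oplus>\<^bsub>N\<^esub>i\<in>A. h i x)"
proof -
  interpret N: module R N by fact
  note c = linear_map_closed[OF assms(3)]
  show ?thesis
    by (intro linear_mapI)
      (use assms(2) c in \<open>simp_all add: linear_map_add[OF assms(3)] linear_map_smult[OF assms(3)]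
         N.finsum_addf N.finsum_smult_ldistr N.finsum_closed Pi_iff cong: N.finsum_cong\<close>)
qed

locale direct_sum = module R M for R (structure) and M (structure) +
  fixes I :: "'i set" and G :: "'i \<Rightarrow> 'c set"
  assumes decomposition: "direct_sum_decomposition R M I G"
begin

text \<open>The condition under the unique existence quantifier of
  \<open>direct_sum_decomposition\<close>. Since f is prescribed outside I as well, it determines f
  as a function, and \<open>comp\<close> can select it by description.\<close>

definition decomposes :: "'c \<Rightarrow> ('i \<Rightarrow> 'c) \<Rightarrow> bool" where
  "decomposes x f \<longleftrightarrow> (\<forall>i\<in>I. f i \<in> G i) \<and> (\<forall>i. i \<notin> I \<longrightarrow> f i = \<zero>\<^bsub>M\<^esub>) \<and>
    finite {i. f i \<noteq> \<zero>\<^bsub>M\<^esub>} \<and> x = (\<Oplus>\<^bsub>M\<^esub>i\<in>{i. f i \<noteq> \<zero>\<^bsub>M\<^esub>}. f i)"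

definition comp :: "'c \<Rightarrow> 'i \<Rightarrow> 'c" where
  "comp x = (THE f. decomposes x f)"

abbreviation support where "support x \<equiv> {i. comp x i \<noteq> \<zero>\<^bsub>M\<^esub>}"

lemma decomposes_ex1: "x \<in> carrier M \<Longrightarrow> \<exists>!f. decomposes x f"
  using decomposition unfolding direct_sum_decomposition_def decomposes_def by blast

lemma submodule_summand: "i \<in> I \<Longrightarrow> submodule (G i) R M"
  using decomposition by (simp add: direct_sum_decomposition_def)

lemma summand_closed: "i \<in> I \<Longrightarrow> x \<in> G i \<Longrightarrow> x \<in> carrier M"
  using submoduleE(1)[OF submodule_summand] by blast

lemma zero_in_summand: "i \<in> I \<Longrightarrow> \<zero>\<^bsub>M\<^esub> \<in> G i"
  using subgroup.one_closed[OF submodule.axioms(1)[OF submodule_summand]] by simp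

lemma
  assumes "x \<in> carrier M"
  shows comp_mem: "i \<in> I \<Longrightarrow> comp x i \<in> G i"
    and comp_outside: "i \<notin> I \<Longrightarrow> comp x i = \<zero>\<^bsub>M\<^esub>"
    and finite_support: "finite (support x)"
    and sum_comp: "x = (\<Oplus>\<^bsub>M\<^esub>i\<in>support x. comp x i)"
proof -
  have "decomposes x (comp x)"
    unfolding comp_def by (rule theI'[OF decomposes_ex1[OF assms]])
  then show "i \<in> I \<Longrightarrow> comp x i \<in> G i" "i \<notin> I \<Longrightarrow> comp x i = \<zero>\<^bsub>M\<^esub>" "finite (support x)"
    "x = (\<Oplus>\<^bsub>M\<^esub>i\<in>support x. comp x i)"
    by (auto simp: decomposes_def)
qed

lemma comp_closed: "x \<in> carrier M \<Longrightarrow> comp x i \<in> carrier M"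
  by (cases "i \<in> I") (auto simp: comp_outside intro: summand_closed comp_mem)

text \<open>A may exceed the support of f. Components of a sum can cancel, so the natural index set
  is the union of two supports.\<close>

lemma comp_unique:
  assumes "x \<in> carrier M" "\<And>i. i \<in> I \<Longrightarrow> f i \<in> G i" "\<And>i. i \<notin> I \<Longrightarrow> f i = \<zero>\<^bsub>M\<^esub>"
    and "finite A" "{i. f i \<noteq> \<zero>\<^bsub>M\<^esub>} \<subseteq> A" "x = (\<Oplus>\<^bsub>M\<^esub>i\<in>A. f i)"
  shows "comp x = f"
proof -
  have "f i \<in> carrier M" for i
    using assms(2,3) summand_closed by (cases "i \<in> I") auto
  then have "(\<Oplus>\<^bsub>M\<^esub>i\<in>{i. f i \<noteq> \<zero>\<^bsub>M\<^esub>}. f i) = (\<Oplus>\<^bsub>M\<^esub>i\<in>A. f i)"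
    by (intro M.add.finprod_mono_neutral_cong_left assms(4,5)) auto
  then have "decomposes x f"
    unfolding decomposes_def using assms finite_subset by auto
  then show ?thesis
    unfolding comp_def using decomposes_ex1[OF assms(1)] by (intro the1_equality)
qed

lemma sum_comp_superset:
  assumes "x \<in> carrier M" "finite A" "support x \<subseteq> A"
  shows "(\<Oplus>\<^bsub>M\<^esub>i\<in>A. comp x i) = x"
proof -
  have "(\<Oplus>\<^bsub>M\<^esub>i\<in>support x. comp x i) = (\<Oplus>\<^bsub>M\<^esub>i\<in>A. comp x i)"
    using comp_closed[OF assms(1)] by (intro M.add.finprod_mono_neutral_cong_left assms) auto
  then show ?thesis using sum_comp[OF assms(1)] by simp
qed

lemma comp_add:
  assumes "x \<in> carrier M" "y \<in> carrier M"
  shows "comp (x \<oplus>\<^bsub>M\<^esub> y) = (\<lambda>i. comp x i \<oplus>\<^bsub>M\<^esub> comp y i)"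
proof (rule comp_unique)
  show "finite (support x \<union> support y)" using assms finite_support by blast
  have "(\<Oplus>\<^bsub>M\<^esub>i\<in>support x \<union> support y. comp x i \<oplus>\<^bsub>M\<^esub> comp y i) =
      (\<Oplus>\<^bsub>M\<^esub>i\<in>support x \<union> support y. comp x i) \<oplus>\<^bsub>M\<^esub> (\<Oplus>\<^bsub>M\<^esub>i\<in>support x \<union> support y. comp y i)"
    using assms comp_closed by (intro M.finsum_addf) auto
  also have "\<dots> = x \<oplus>\<^bsub>M\<^esub> y"
    using assms finite_support
    by (subst (1 2) sum_comp_superset) auto
  finally show "x \<oplus>\<^bsub>M\<^esub> y = (\<Oplus>\<^bsub>M\<^esub>i\<in>support x \<union> support y. comp x i \<oplus>\<^bsub>M\<^esub> comp y i)" by simp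
  show "comp x i \<oplus>\<^bsub>M\<^esub> comp y i \<in> G i" if "i \<in> I" for i
    using assms that comp_mem submoduleE(5)[OF submodule_summand] by blast
qed (use assms comp_outside in auto)

lemma comp_smult:
  assumes "a \<in> carrier R" "x \<in> carrier M"
  shows "comp (a \<odot>\<^bsub>M\<^esub> x) = (\<lambda>i. a \<odot>\<^bsub>M\<^esub> comp x i)"
proof (rule comp_unique)
  show "finite (support x)" using assms finite_support by blast
  have "(\<Oplus>\<^bsub>M\<^esub>i\<in>support x. a \<odot>\<^bsub>M\<^esub> comp x i) = a \<odot>\<^bsub>M\<^esub> (\<Oplus>\<^bsub>M\<^esub>i\<in>support x. comp x i)"
    using assms comp_closed finite_support by (intro finsum_smult_ldistr[symmetric]) auto
  also have "\<dots> = a \<odot>\<^bsub>M\<^esub> x" using assms sum_comp by simp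
  finally show "a \<odot>\<^bsub>M\<^esub> x = (\<Oplus>\<^bsub>M\<^esub>i\<in>support x. a \<odot>\<^bsub>M\<^esub> comp x i)" by simp
  show "a \<odot>\<^bsub>M\<^esub> comp x i \<in> G i" if "i \<in> I" for i
    using assms that comp_mem submoduleE(4)[OF submodule_summand] by blast
qed (use assms comp_outside in auto)

lemma comp_summand:
  assumes "i \<in> I" "x \<in> G i"
  shows "comp x = (\<lambda>j. if j = i then x else \<zero>\<^bsub>M\<^esub>)"
proof (rule comp_unique)
  show "x = (\<Oplus>\<^bsub>M\<^esub>j\<in>{i}. if j = i then x else \<zero>\<^bsub>M\<^esub>)"
    using summand_closed[OF assms] by (simp add: M.finsum_insert M.finsum_empty)
qed (use assms summand_closed zero_in_summand in auto)

text \<open>The device by which identities pass from homogeneous elements to all elements, one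
  variable at a time.\<close>

lemma linear_maps_eq_on_summands:
  assumes N: "module R N" and h: "linear_map R M N h" and k: "linear_map R M N k"
    and eq: "\<And>i x. i \<in> I \<Longrightarrow> x \<in> G i \<Longrightarrow> h x = k x" and x: "x \<in> carrier M"
  shows "h x = k x"
proof -
  interpret N: module R N by fact
  have "h (comp x i) = k (comp x i)" for i
    using eq comp_mem[OF x] comp_outside[OF x] linear_map_zero[OF module_axioms N h]
      linear_map_zero[OF module_axioms N k] by (cases "i \<in> I") auto
  then have "h (\<Oplus>\<^bsub>M\<^esub>i\<in>support x. comp x i) = k (\<Oplus>\<^bsub>M\<^esub>i\<in>support x. comp x i)"
    using comp_closed[OF x]
    by (simp add: linear_map_finsum[OF module_axioms N h] linear_map_finsum[OF module_axioms N k])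
  then show ?thesis using sum_comp[OF x] by simp
qed

text \<open>The map out of the direct sum that restricts to \<open>h i\<close> on the summand
  \<open>G i\<close>. Taking each \<open>h i\<close> on all of M avoids treating the summands as
  modules of their own.\<close>

definition graded_extension where
  "graded_extension N h x = (\<Oplus>\<^bsub>N\<^esub>i\<in>support x. h i (comp x i))"

lemma graded_extension_superset:
  assumes "module R N" "\<And>i. linear_map R M N (h i)" "x \<in> carrier M" "finite A" "support x \<subseteq> A"
  shows "graded_extension N h x = (\<Oplus>\<^bsub>N\<^esub>i\<in>A. h i (comp x i))"
proof -
  interpret N: module R N by fact
  show ?thesis
    unfolding graded_extension_def
  proof (rule N.add.finprod_mono_neutral_cong_left[OF assms(4,5)])
    show "h i (comp x i) = \<zero>\<^bsub>N\<^esub>" if "i \<in> A - support x" for i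
      using that linear_map_zero[OF module_axioms assms(1,2)] by simp
    show "(\<lambda>i. h i (comp x i)) \<in> A \<rightarrow> carrier N"
      using linear_map_closed[OF assms(2) comp_closed[OF assms(3)]] by simp
  qed simp
qed

lemma linear_map_graded_extension:
  assumes N: "module R N" and h: "\<And>i. linear_map R M N (h i)"
  shows "linear_map R M N (graded_extension N h)"
proof -
  interpret N: module R N by fact
  have c: "h i (comp x i) \<in> carrier N" if "x \<in> carrier M" for x i
    using linear_map_closed[OF h comp_closed[OF that]] .
  show ?thesis
  proof (rule linear_mapI)
    fix x assume x: "x \<in> carrier M"
    show "graded_extension N h x \<in> carrier N"
      unfolding graded_extension_def using c[OF x] by (intro N.finsum_closed) auto
    {
      fix y assume y: "y \<in> carrier M"
      let ?A = "support x \<union> support y"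
      have A: "finite ?A" using x y finite_support by blast
      have "support (x \<oplus>\<^bsub>M\<^esub> y) \<subseteq> ?A" using x y by (auto simp: comp_add)
      then have "graded_extension N h (x \<oplus>\<^bsub>M\<^esub> y) = (\<Oplus>\<^bsub>N\<^esub>i\<in>?A. h i (comp x i) \<oplus>\<^bsub>N\<^esub> h i (comp y i))"
        using graded_extension_superset[OF N h _ A, of "x \<oplus>\<^bsub>M\<^esub> y"] x y
        by (simp add: comp_add linear_map_add[OF h] comp_closed)
      also have "\<dots> = (\<Oplus>\<^bsub>N\<^esub>i\<in>?A. h i (comp x i)) \<oplus>\<^bsub>N\<^esub> (\<Oplus>\<^bsub>N\<^esub>i\<in>?A. h i (comp y i))"
        using c x y by (intro N.finsum_addf) auto
      also have "\<dots> = graded_extension N h x \<oplus>\<^bsub>N\<^esub> graded_extension N h y"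
        using graded_extension_superset[OF N h x A] graded_extension_superset[OF N h y A] by simp
      finally show "graded_extension N h (x \<oplus>\<^bsub>M\<^esub> y) = graded_extension N h x \<oplus>\<^bsub>N\<^esub> graded_extension N h y" .
    }
    fix a assume a: "a \<in> carrier R"
    have "support (a \<odot>\<^bsub>M\<^esub> x) \<subseteq> support x" using a x by (auto simp: comp_smult)
    then have "graded_extension N h (a \<odot>\<^bsub>M\<^esub> x) = (\<Oplus>\<^bsub>N\<^esub>i\<in>support x. a \<odot>\<^bsub>N\<^esub> h i (comp x i))"
      using graded_extension_superset[OF N h _ finite_support[OF x], of "a \<odot>\<^bsub>M\<^esub> x"] a x
      by (simp add: comp_smult linear_map_smult[OF h] comp_closed)
    also have "\<dots> = a \<odot>\<^bsub>N\<^esub> graded_extension N h x"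
      unfolding graded_extension_def
      using a c[OF x] by (intro N.finsum_smult_ldistr[symmetric] finite_support x) auto
    finally show "graded_extension N h (a \<odot>\<^bsub>M\<^esub> x) = a \<odot>\<^bsub>N\<^esub> graded_extension N h x" .
  qed
qed

lemma graded_extension_summand:
  assumes N: "module R N" and h: "\<And>i. linear_map R M N (h i)" and "i \<in> I" "x \<in> G i"
  shows "graded_extension N h x = h i x"
proof -
  interpret N: module R N by fact
  note x = summand_closed[OF assms(3,4)]
  have "support x \<subseteq> {i}" using comp_summand[OF assms(3,4)] by auto
  then show ?thesis
    using graded_extension_superset[OF N h x, of "{i}"] linear_map_closed[OF h x] comp_summand[OF assms(3,4)]
    by (simp add: N.finsum_insert N.finsum_empty)
qed

text \<open>The index set is the support of x, which does not move with the parameter v, so this is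
  a fixed finite sum of linear maps. It provides linearity in the variable over which a graded
  extension does not range.\<close>

lemma linear_map_graded_extension_parameter:
  assumes N: "module R N" and h: "\<And>i y. y \<in> carrier M \<Longrightarrow> linear_map R P N (\<lambda>v. h v i y)"
    and x: "x \<in> carrier M"
  shows "linear_map R P N (\<lambda>v. graded_extension N (h v) x)"
  unfolding graded_extension_def
  by (intro linear_map_sum[OF N] finite_support h comp_closed x)

end

section \<open>The null homotopy\<close>

context lie_algebra
begin

text \<open>The six terms of \<open>\<partial>\<^sub>4\<close> pair up under symmetry of the product
  to \<open>-2p + 2q - 2r\<close>, and the product of a with the Jacobi identity for b, c, d reads
  \<open>p - q + r = 0\<close>.\<close>

lemma koszul_ce_boundary_4:
  assumes "u \<in> carrier (ext 4)"
  shows "koszul_map R L (ce_boundary R L 4 u) = \<zero>\<^bsub>Kill\<^esub>"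
proof -
  interpret K: module R Kill by (rule killing_module_module)
  interpret E: module R "ext 3" by (rule exterior_power_module)
  note [simp] = linear_map_add[OF linear_map_koszul_map]
    linear_map_neg[OF E.module_axioms K.module_axioms linear_map_koszul_map]
  have wc[simp]: "w [u, v, t] \<in> carrier (ext 3)" if "u \<in> carrier L" "v \<in> carrier L" "t \<in> carrier L" for u v t
    using that by (intro wedge_closed) (simp add: tuples_conv)
  have "koszul_map R L (ce_boundary R L 4 (w xs)) = \<zero>\<^bsub>Kill\<^esub>" if "xs \<in> tuples L 4" for xs
  proof -
    obtain a b c d where xs: "xs = [a, b, c, d]"
      and L: "a \<in> carrier L" "b \<in> carrier L" "c \<in> carrier L" "d \<in> carrier L"
      using \<open>xs \<in> tuples L 4\<close> by (auto simp: tuples_conv)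
    note B = bracket_closed
    define p where "p = killing_prod \<lbrace>a, b\<rbrace> \<lbrace>c, d\<rbrace>"
    define q where "q = killing_prod \<lbrace>a, c\<rbrace> \<lbrace>b, d\<rbrace>"
    define r where "r = killing_prod \<lbrace>a, d\<rbrace> \<lbrace>b, c\<rbrace>"
    have pqr: "p \<in> carrier Kill" "q \<in> carrier Kill" "r \<in> carrier Kill"
      using L by (auto simp: p_def q_def r_def intro!: killing_prod_closed B)
    have "killing_prod a (\<lbrace>b, \<lbrace>c, d\<rbrace>\<rbrace> \<oplus>\<^bsub>L\<^esub> \<lbrace>c, \<lbrace>d, b\<rbrace>\<rbrace> \<oplus>\<^bsub>L\<^esub> \<lbrace>d, \<lbrace>b, c\<rbrace>\<rbrace>) = \<zero>\<^bsub>Kill\<^esub>"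
      using L by (simp add: jacobi killing_prod_zero)
    moreover have "killing_prod a (\<lbrace>b, \<lbrace>c, d\<rbrace>\<rbrace> \<oplus>\<^bsub>L\<^esub> \<lbrace>c, \<lbrace>d, b\<rbrace>\<rbrace> \<oplus>\<^bsub>L\<^esub> \<lbrace>d, \<lbrace>b, c\<rbrace>\<rbrace>) =
        killing_prod a \<lbrace>b, \<lbrace>c, d\<rbrace>\<rbrace> \<oplus>\<^bsub>Kill\<^esub> killing_prod a \<lbrace>c, \<lbrace>d, b\<rbrace>\<rbrace> \<oplus>\<^bsub>Kill\<^esub> killing_prod a \<lbrace>d, \<lbrace>b, c\<rbrace>\<rbrace>"
      using L by (simp add: linear_map_add[OF linear_map_killing_prod(2)] B)
    \<comment> \<open>Invariance turns \<open>a \<cdot> [b, [c, d]]\<close> into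
      \<open>[a, b] \<cdot> [c, d]\<close>; the middle term of the Jacobi sum contains
      \<open>[d, b]\<close> instead of \<open>[b, d]\<close>, whence its sign.\<close>
    moreover have "killing_prod a \<lbrace>b, \<lbrace>c, d\<rbrace>\<rbrace> = p" "killing_prod a \<lbrace>d, \<lbrace>b, c\<rbrace>\<rbrace> = r"
      using L by (simp_all add: p_def r_def killing_prod_bracket B)
    moreover have "killing_prod a \<lbrace>c, \<lbrace>d, b\<rbrace>\<rbrace> = \<ominus>\<^bsub>Kill\<^esub> q"
      using L linear_map_neg[OF module_axioms K.module_axioms linear_map_killing_prod(2)]
      by (simp add: q_def B bracket_swap[of b d] flip: killing_prod_bracket)
    ultimately have "p \<oplus>\<^bsub>Kill\<^esub> \<ominus>\<^bsub>Kill\<^esub> q \<oplus>\<^bsub>Kill\<^esub> r = \<zero>\<^bsub>Kill\<^esub>" by simp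
    then have "(p \<oplus>\<^bsub>Kill\<^esub> r) \<oplus>\<^bsub>Kill\<^esub> \<ominus>\<^bsub>Kill\<^esub> q = \<zero>\<^bsub>Kill\<^esub>"
      using pqr by (simp add: K.a_ac)
    then have q: "q = p \<oplus>\<^bsub>Kill\<^esub> r"
      using pqr K.minus_equality[of "p \<oplus>\<^bsub>Kill\<^esub> r" "\<ominus>\<^bsub>Kill\<^esub> q"] by simp
    have "killing_prod \<lbrace>b, c\<rbrace> \<lbrace>a, d\<rbrace> = r" "killing_prod \<lbrace>b, d\<rbrace> \<lbrace>a, c\<rbrace> = q" "killing_prod \<lbrace>c, d\<rbrace> \<lbrace>a, b\<rbrace> = p"
      using L by (simp_all add: p_def q_def r_def B killing_prod_commute)
    then have "koszul_map R L (ce_boundary R L 4 (w xs)) =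
      \<ominus>\<^bsub>Kill\<^esub> p \<oplus>\<^bsub>Kill\<^esub> ((q \<oplus>\<^bsub>Kill\<^esub> \<ominus>\<^bsub>Kill\<^esub> r) \<oplus>\<^bsub>Kill\<^esub> (\<ominus>\<^bsub>Kill\<^esub> r \<oplus>\<^bsub>Kill\<^esub> (q \<oplus>\<^bsub>Kill\<^esub> \<ominus>\<^bsub>Kill\<^esub> p)))"
      using L by (simp add: xs ce_boundary_4_wedge koszul_map_wedge B flip: p_def q_def r_def)
    also have "\<dots> = \<zero>\<^bsub>Kill\<^esub>"
      using pqr by (simp add: q K.a_assoc K.r_neg K.r_neg1 K.r_neg2 K.l_neg)
        (simp add: K.a_ac K.add_add_minus_minus)
    finally show ?thesis .
  qed
  then show ?thesis
    using linear_maps_eq_on_exterior_power[OF K.module_axioms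
        linear_map_comp[OF linear_map_ce_boundary_4 linear_map_koszul_map]
        linear_map_zero_map[OF K.module_axioms]] assms by blast
qed

text \<open>The homotopy argument for an arbitrary \<Phi>: being alternating and bilinear, \<Phi>
  induces a linear map \<open>T\<close> on the exterior square, and \<open>htpy\<close> says on
  wedges that \<open>T\<close> after \<open>\<partial>\<^sub>3\<close> is minus the Koszul map. On a
  cycle \<open>T\<close> is evaluated at zero.\<close>

lemma koszul_map_cycle:
  assumes l: "\<And>v. v \<in> carrier L \<Longrightarrow> linear_map R L Kill (\<lambda>u. \<Phi> u v)"
    and r: "\<And>u. u \<in> carrier L \<Longrightarrow> linear_map R L Kill (\<lambda>v. \<Phi> u v)"
    and alt: "\<And>u. u \<in> carrier L \<Longrightarrow> \<Phi> u u = \<zero>\<^bsub>Kill\<^esub>"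
    and htpy: "\<And>x y z. x \<in> carrier L \<Longrightarrow> y \<in> carrier L \<Longrightarrow> z \<in> carrier L \<Longrightarrow>
      \<ominus>\<^bsub>Kill\<^esub> \<Phi> \<lbrace>x, y\<rbrace> z \<oplus>\<^bsub>Kill\<^esub> (\<Phi> \<lbrace>x, z\<rbrace> y \<oplus>\<^bsub>Kill\<^esub> \<ominus>\<^bsub>Kill\<^esub> \<Phi> \<lbrace>y, z\<rbrace> x) = \<ominus>\<^bsub>Kill\<^esub> killing_prod x \<lbrace>y, z\<rbrace>"
    and u: "u \<in> ce_cycles R L 3"
  shows "koszul_map R L u = \<zero>\<^bsub>Kill\<^esub>"
proof -
  interpret K: module R Kill by (rule killing_module_module)
  interpret E: module R "ext 2" by (rule exterior_power_module)
  have u: "u \<in> carrier (ext 3)" "ce_boundary R L 3 u = \<zero>\<^bsub>ext 2\<^esub>"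
    using u by (auto simp: ce_cycles_def a_kernel_def')
  let ?\<phi> = "\<lambda>xs. \<Phi> (xs ! 0) (xs ! 1)"
  have ml: "multilinear R L Kill 2 ?\<phi>"
    by (rule multilinear2I) (simp_all add: l r)
  have alt': "?\<phi> xs = \<zero>\<^bsub>Kill\<^esub>" if "xs \<in> tuples L 2" "\<not> distinct xs" for xs
    using that alt by (auto simp: tuples_conv)
  define T where "T = tuple_lift R Kill ?\<phi>"
  have T: "linear_map R (ext 2) Kill T"
    unfolding T_def by (rule exterior_lift(1)[OF K.module_axioms ml alt'])
  have Tw: "T (w [x, y]) = \<Phi> x y" if "x \<in> carrier L" "y \<in> carrier L" for x y
    using exterior_lift(2)[OF K.module_axioms ml alt', of "[x, y]"] that
    by (simp add: T_def tuples_conv)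
  have wc: "w [u, v] \<in> carrier (ext 2)" if "u \<in> carrier L" "v \<in> carrier L" for u v
    using that by (intro wedge_closed) (simp add: tuples_conv)
  have "T (ce_boundary R L 3 u) = \<ominus>\<^bsub>Kill\<^esub> koszul_map R L u"
  proof (rule linear_maps_eq_on_exterior_power[OF K.module_axioms
        linear_map_comp[OF linear_map_ce_boundary_3 T]
        linear_map_uminus[OF K.module_axioms linear_map_koszul_map] _ u(1)])
    fix xs assume "xs \<in> tuples L 3"
    then obtain x y z where xs: "xs = [x, y, z]"
      and L: "x \<in> carrier L" "y \<in> carrier L" "z \<in> carrier L"
      by (auto simp: tuples_conv)
    have "T (ce_boundary R L 3 (w xs)) =
        \<ominus>\<^bsub>Kill\<^esub> \<Phi> \<lbrace>x, y\<rbrace> z \<oplus>\<^bsub>Kill\<^esub> (\<Phi> \<lbrace>x, z\<rbrace> y \<oplus>\<^bsub>Kill\<^esub> \<ominus>\<^bsub>Kill\<^esub> \<Phi> \<lbrace>y, z\<rbrace> x)"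
      using L by (simp add: xs ce_boundary_3_wedge linear_map_add[OF T] wc bracket_closed Tw
          linear_map_neg[OF E.module_axioms K.module_axioms T])
    then show "T (ce_boundary R L 3 (w xs)) = \<ominus>\<^bsub>Kill\<^esub> koszul_map R L (w xs)"
      using L htpy by (simp add: xs koszul_map_wedge)
  qed
  then have "\<ominus>\<^bsub>Kill\<^esub> koszul_map R L u = \<zero>\<^bsub>Kill\<^esub>"
    using u(2) linear_map_zero[OF E.module_axioms K.module_axioms T] by simp
  then show ?thesis
    using linear_map_closed[OF linear_map_koszul_map u(1)] K.minus_minus K.minus_zero_eq by metis
qed

text \<open>A homology class is the set of all sums of a boundary and one cycle z. The Koszul map
  kills both summands, so its image of the class is the singleton of zero.\<close>

lemma reduced_koszul_map_eq_zero:
  assumes cyc: "\<And>u. u \<in> ce_cycles R L 3 \<Longrightarrow> koszul_map R L u = \<zero>\<^bsub>Kill\<^esub>"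
    and c: "c \<in> carrier (ce_homology R L 3)"
  shows "reduced_koszul_map R L c = \<zero>\<^bsub>Kill\<^esub>"
proof -
  interpret K: module R Kill by (rule killing_module_module)
  interpret E: module R "ext 3" by (rule exterior_power_module)
  obtain z where z: "z \<in> ce_cycles R L 3" and cz: "c = (\<lambda>b. b \<oplus>\<^bsub>ext 3\<^esub> z) ` ce_boundaries R L 3"
    using c by (auto simp: ce_homology_def quot_module_simps(1) a_r_coset_def')
  have "z \<in> carrier (ext 3)" using z by (simp add: ce_cycles_def a_kernel_def')
  then have "koszul_map R L (b \<oplus>\<^bsub>ext 3\<^esub> z) = \<zero>\<^bsub>Kill\<^esub>" if "b \<in> ce_boundaries R L 3" for b
    using that cyc[OF z] linear_map_closed[OF linear_map_ce_boundary_4]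
    by (auto simp: ce_boundaries_def linear_map_add[OF linear_map_koszul_map] koszul_ce_boundary_4)
  \<comment> \<open>An empty class would have empty image, and \<open>the_elem\<close> would be
    undetermined.\<close>
  moreover have "ce_boundaries R L 3 \<noteq> {}"
    using module.carrier_is_submodule[OF exterior_power_module]
      module.submoduleE(2)[OF exterior_power_module] by (auto simp: ce_boundaries_def)
  ultimately have "koszul_map R L ` c = {\<zero>\<^bsub>Kill\<^esub>}"
    unfolding cz by blast
  then show ?thesis by (simp add: reduced_koszul_map_def quot_induced_def)
qed

text \<open>\<rho> stands for the structure map of a rational algebra. The coefficients of \<Phi>
  are only added, negated and compared with 1, so an additive map preserving 1 supplies what the
  argument uses.\<close>

lemma exists_null_homotopy:
  fixes \<rho> :: "rat \<Rightarrow> 'r"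
  assumes grading: "lie_grading_pos R L G"
    and \<rho>: "\<And>p. \<rho> p \<in> carrier R" "\<And>p q. \<rho> (p + q) = \<rho> p \<oplus>\<^bsub>R\<^esub> \<rho> q" "\<rho> 1 = \<one>\<^bsub>R\<^esub>"
  obtains \<Phi> where "\<And>v. v \<in> carrier L \<Longrightarrow> linear_map R L Kill (\<lambda>u. \<Phi> u v)"
    and "\<And>u. u \<in> carrier L \<Longrightarrow> linear_map R L Kill (\<lambda>v. \<Phi> u v)"
    and "\<And>u. u \<in> carrier L \<Longrightarrow> \<Phi> u u = \<zero>\<^bsub>Kill\<^esub>"
    and "\<And>x y z. x \<in> carrier L \<Longrightarrow> y \<in> carrier L \<Longrightarrow> z \<in> carrier L \<Longrightarrow>
      \<ominus>\<^bsub>Kill\<^esub> \<Phi> \<lbrace>x, y\<rbrace> z \<oplus>\<^bsub>Kill\<^esub> (\<Phi> \<lbrace>x, z\<rbrace> y \<oplus>\<^bsub>Kill\<^esub> \<ominus>\<^bsub>Kill\<^esub> \<Phi> \<lbrace>y, z\<rbrace> x) = \<ominus>\<^bsub>Kill\<^esub> killing_prod x \<lbrace>y, z\<rbrace>"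
proof -
  interpret K: module R Kill by (rule killing_module_module)
  interpret direct_sum R L "{1::nat..}" G
    using grading by unfold_locales (simp add: lie_grading_pos_def)
  have \<rho>0: "\<rho> 0 = \<zero>\<^bsub>R\<^esub>"
    using \<rho>(1)[of 0] \<rho>(2)[of 0 0] R.add.r_cancel_one' by simp
  have \<rho>m: "\<rho> (- p) = \<ominus>\<^bsub>R\<^esub> \<rho> p" for p
    using \<rho>(1) \<rho>(2)[of "- p" p] \<rho>0 R.minus_equality by simp
  \<comment> \<open>The numerator is antisymmetric to compensate the symmetry of the product. At m =
    n = 0 the quotient is 0 by convention; components in degree 0 are zero anyway.\<close>
  define q :: "nat \<Rightarrow> nat \<Rightarrow> rat" where "q m n = (of_nat m - of_nat n) / (of_nat m + of_nat n)" for m n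
  define \<kappa> where "\<kappa> m n x y = \<rho> (q m n) \<odot>\<^bsub>Kill\<^esub> killing_prod x y" for m n x y
  \<comment> \<open>The coefficient depends on both degrees, so both arguments are split into
    components: the outer extension runs over those of u, the inner one over those of v.\<close>
  define \<Phi> where "\<Phi> u v = graded_extension Kill (\<lambda>m x. graded_extension Kill (\<lambda>n y. \<kappa> m n x y) v) u" for u v
  have \<kappa>1: "linear_map R L Kill (\<lambda>x. \<kappa> m n x y)" if "y \<in> carrier L" for m n y
    unfolding \<kappa>_def by (intro linear_map_scale linear_map_killing_prod that K.module_axioms \<rho>)
  have \<kappa>2: "linear_map R L Kill (\<lambda>y. \<kappa> m n x y)" if "x \<in> carrier L" for m n x
    unfolding \<kappa>_def by (intro linear_map_scale linear_map_killing_prod that K.module_axioms \<rho>)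
  have inner1: "linear_map R L Kill (\<lambda>x. graded_extension Kill (\<lambda>n y. \<kappa> m n x y) v)"
    if "v \<in> carrier L" for m v
    by (intro linear_map_graded_extension_parameter[OF K.module_axioms] \<kappa>1 that)
  have inner2: "linear_map R L Kill (\<lambda>v. graded_extension Kill (\<lambda>n y. \<kappa> m n x y) v)"
    if "x \<in> carrier L" for m x
    by (intro linear_map_graded_extension[OF K.module_axioms] \<kappa>2 that)
  have l: "linear_map R L Kill (\<lambda>u. \<Phi> u v)" if "v \<in> carrier L" for v
    unfolding \<Phi>_def by (intro linear_map_graded_extension[OF K.module_axioms] inner1 that)
  have r: "linear_map R L Kill (\<lambda>v. \<Phi> u v)" if "u \<in> carrier L" for u
    unfolding \<Phi>_def by (intro linear_map_graded_extension_parameter[OF K.module_axioms] inner2 that)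
  have homog: "\<Phi> u v = \<rho> (q m n) \<odot>\<^bsub>Kill\<^esub> killing_prod u v"
    if "m \<ge> 1" "n \<ge> 1" "u \<in> G m" "v \<in> G n" for m n u v
  proof -
    have uv: "u \<in> carrier L" "v \<in> carrier L" using that summand_closed[of m] summand_closed[of n] by auto
    have "\<Phi> u v = graded_extension Kill (\<lambda>n y. \<kappa> m n u y) v"
      unfolding \<Phi>_def using graded_extension_summand[OF K.module_axioms inner1] uv that by simp
    also have "\<dots> = \<kappa> m n u v"
      using graded_extension_summand[OF K.module_axioms \<kappa>2] uv that by simp
    finally show ?thesis by (simp add: \<kappa>_def)
  qed
  have c: "\<Phi> u v \<in> carrier Kill" if "u \<in> carrier L" "v \<in> carrier L" for u v
    using linear_map_closed[OF l] that by simp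
  note zero = linear_map_zero_map[OF K.module_axioms]
  \<comment> \<open>Vanishing on the diagonal is not a linear condition and cannot be checked on
    homogeneous elements alone. Skew-symmetry is linear in each variable, so it extends.\<close>
  have skew: "\<Phi> u v \<oplus>\<^bsub>Kill\<^esub> \<Phi> v u = \<zero>\<^bsub>Kill\<^esub>" if "u \<in> carrier L" "v \<in> carrier L" for u v
  proof (rule linear_maps_eq_on_summands[OF K.module_axioms linear_map_plus[OF K.module_axioms l r] zero _ that(1)])
    fix m u assume u: "m \<in> {1..}" "u \<in> G m"
    then have uL: "u \<in> carrier L" by (rule summand_closed)
    show "\<Phi> u v \<oplus>\<^bsub>Kill\<^esub> \<Phi> v u = \<zero>\<^bsub>Kill\<^esub>"
    proof (rule linear_maps_eq_on_summands[OF K.module_axioms linear_map_plus[OF K.module_axioms r l] zero _ that(2)])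
      fix n v assume v: "n \<in> {1..}" "v \<in> G n"
      then have vL: "v \<in> carrier L" by (rule summand_closed)
      have "q n m = - q m n" 
        using minus_divide_left[of "of_nat m - of_nat n :: rat" "of_nat m + of_nat n"]
        by (simp add: q_def add.commute)
      then show "\<Phi> u v \<oplus>\<^bsub>Kill\<^esub> \<Phi> v u = \<zero>\<^bsub>Kill\<^esub>"
        using u v uL vL \<rho>(1) killing_prod_closed[OF uL vL]
        by (simp add: homog killing_prod_commute[OF vL uL] \<rho>m K.smult_l_minus K.r_neg)
    qed (fact uL)+
  qed (fact that(2))+
  have alt: "\<Phi> u u = \<zero>\<^bsub>Kill\<^esub>" if u: "u \<in> carrier L" for u
  proof -
    \<comment> \<open>Skew-symmetry only gives that twice \<open>\<Phi> u u\<close> is zero; one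
      half in R removes the factor.\<close>
    have "\<rho> (1/2) \<oplus>\<^bsub>R\<^esub> \<rho> (1/2) = \<one>\<^bsub>R\<^esub>"
      using \<rho>(2)[of "1/2" "1/2"] \<rho>(3) by simp
    then have "\<Phi> u u = (\<rho> (1/2) \<oplus>\<^bsub>R\<^esub> \<rho> (1/2)) \<odot>\<^bsub>Kill\<^esub> \<Phi> u u" using c[OF u u] by simp
    also have "\<dots> = \<rho> (1/2) \<odot>\<^bsub>Kill\<^esub> (\<Phi> u u \<oplus>\<^bsub>Kill\<^esub> \<Phi> u u)"
      using c[OF u u] \<rho>(1) by (simp add: K.smult_l_distr K.smult_r_distr)
    finally show ?thesis using skew[OF u u] \<rho>(1) by simp
  qed
  \<comment> \<open>\<open>?D\<close> is \<Phi> applied to the boundary of the wedge of x, y and z,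
    and \<open>?K\<close> is minus the Koszul map on that wedge.\<close>
  let ?D = "\<lambda>x y z. \<ominus>\<^bsub>Kill\<^esub> \<Phi> \<lbrace>x, y\<rbrace> z \<oplus>\<^bsub>Kill\<^esub> (\<Phi> \<lbrace>x, z\<rbrace> y \<oplus>\<^bsub>Kill\<^esub> \<ominus>\<^bsub>Kill\<^esub> \<Phi> \<lbrace>y, z\<rbrace> x)"
  let ?K = "\<lambda>x y z. \<ominus>\<^bsub>Kill\<^esub> killing_prod x \<lbrace>y, z\<rbrace>"
  note lin = linear_map_plus linear_map_uminus K.module_axioms l r bracket_closed
    linear_map_comp[OF linear_map_bracket(1) l] linear_map_comp[OF linear_map_bracket(2) l]
    linear_map_killing_prod(1) linear_map_killing_prod_bracket
  have hom3: "?D x y z = ?K x y z"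
    if *: "a \<ge> 1" "b \<ge> 1" "c \<ge> 1" "x \<in> G a" "y \<in> G b" "z \<in> G c" for a b c x y z
  proof -
    have L: "x \<in> carrier L" "y \<in> carrier L" "z \<in> carrier L"
      using * summand_closed[of a] summand_closed[of b] summand_closed[of c] by auto
    have br: "\<lbrace>x, y\<rbrace> \<in> G (a + b)" "\<lbrace>x, z\<rbrace> \<in> G (a + c)" "\<lbrace>y, z\<rbrace> \<in> G (b + c)"
      using grading * unfolding lie_grading_pos_def by blast+
    define t where "t = killing_prod x \<lbrace>y, z\<rbrace>"
    have t: "t \<in> carrier Kill" using L by (simp add: t_def killing_prod_closed bracket_closed)
    have k1: "killing_prod \<lbrace>x, y\<rbrace> z = t" using L by (simp add: t_def killing_prod_bracket)
    \<comment> \<open>\<open>[x, z] \<cdot> y = x \<cdot> [z, y]\<close>, so the middle product is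
      minus t. This offsets the plus sign of the middle term of \<open>?D\<close>, and all three
      coefficients enter with the same sign.\<close>
    have k2: "killing_prod \<lbrace>x, z\<rbrace> y = \<ominus>\<^bsub>Kill\<^esub> t"
      using L linear_map_neg[OF module_axioms K.module_axioms linear_map_killing_prod(2)]
      by (simp add: t_def killing_prod_bracket bracket_swap[of y z] bracket_closed)
    have k3: "killing_prod \<lbrace>y, z\<rbrace> x = t"
      using L by (simp add: t_def killing_prod_commute bracket_closed)
    have "?D x y z = \<ominus>\<^bsub>Kill\<^esub> (\<rho> (q (a + b) c) \<odot>\<^bsub>Kill\<^esub> t) \<oplus>\<^bsub>Kill\<^esub>
        (\<ominus>\<^bsub>Kill\<^esub> (\<rho> (q (a + c) b) \<odot>\<^bsub>Kill\<^esub> t) \<oplus>\<^bsub>Kill\<^esub> \<ominus>\<^bsub>Kill\<^esub> (\<rho> (q (b + c) a) \<odot>\<^bsub>Kill\<^esub> t))"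
      using * br t \<rho>(1) by (simp add: homog[of "a + b" c] homog[of "a + c" b] homog[of "b + c" a] k1 k2 k3 K.smult_r_minus)
    also have "\<dots> = \<ominus>\<^bsub>Kill\<^esub> (\<rho> (q (a + b) c + (q (a + c) b + q (b + c) a)) \<odot>\<^bsub>Kill\<^esub> t)"
      using t \<rho>(1) by (simp add: \<rho>(2) K.smult_l_distr K.minus_add)
    also have "q (a + b) c + (q (a + c) b + q (b + c) a) = 1"
    proof -
      let ?s = "of_nat a + of_nat b + of_nat c :: rat"
      \<comment> \<open>Positivity of the degrees is used here: the three numerators add up to the
        total degree, which must be nonzero to be cancelled.\<close>
      have "?s > 0" using *(1) by simp
      moreover have "q (a + b) c = (of_nat a + of_nat b - of_nat c) / ?s"
        "q (a + c) b = (of_nat a + of_nat c - of_nat b) / ?s"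
        "q (b + c) a = (of_nat b + of_nat c - of_nat a) / ?s"
        by (simp_all add: q_def add_ac)
      ultimately show ?thesis by (simp flip: add_divide_distrib)
    qed
    finally show ?thesis using t \<rho>(3) by (simp add: t_def)
  qed
  \<comment> \<open>Both sides are linear in each variable. Homogeneity is dropped first for z, then
    for y, then for x.\<close>
  have hom2: "?D x y z = ?K x y z"
    if *: "a \<ge> 1" "b \<ge> 1" "x \<in> G a" "y \<in> G b" "z \<in> carrier L" for a b x y z
  proof -
    have L: "x \<in> carrier L" "y \<in> carrier L"
      using * summand_closed[of a] summand_closed[of b] by auto
    have D: "linear_map R L Kill (\<lambda>z. ?D x y z)" and K: "linear_map R L Kill (\<lambda>z. ?K x y z)"
      by (intro lin L)+
    show ?thesis
      by (rule linear_maps_eq_on_summands[OF K.module_axioms D K _ *(5)]) (rule hom3[OF *(1,2) _ *(3,4)], auto)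
  qed
  have hom1: "?D x y z = ?K x y z"
    if *: "a \<ge> 1" "x \<in> G a" "y \<in> carrier L" "z \<in> carrier L" for a x y z
  proof -
    have L: "x \<in> carrier L" using * summand_closed[of a] by auto
    have D: "linear_map R L Kill (\<lambda>y. ?D x y z)" and K: "linear_map R L Kill (\<lambda>y. ?K x y z)"
      by (intro lin L *)+
    show ?thesis
      by (rule linear_maps_eq_on_summands[OF K.module_axioms D K _ *(3)]) (rule hom2[OF *(1) _ *(2) _ *(4)], auto)
  qed
  have "?D x y z = ?K x y z" if *: "x \<in> carrier L" "y \<in> carrier L" "z \<in> carrier L" for x y z
  proof -
    have D: "linear_map R L Kill (\<lambda>x. ?D x y z)" and K: "linear_map R L Kill (\<lambda>x. ?K x y z)"
      by (intro lin *)+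
    show ?thesis
      by (rule linear_maps_eq_on_summands[OF K.module_axioms D K _ *(1)]) (rule hom1[OF _ _ *(2,3)], auto)
  qed
  then show thesis using that[of \<Phi>] l r alt by blast
qed

lemma reduced_koszul_map_graded:
  fixes \<rho> :: "rat \<Rightarrow> 'r"
  assumes "lie_grading_pos R L G"
    and "\<And>p. \<rho> p \<in> carrier R" "\<And>p q. \<rho> (p + q) = \<rho> p \<oplus>\<^bsub>R\<^esub> \<rho> q" "\<rho> 1 = \<one>\<^bsub>R\<^esub>"
    and "c \<in> carrier (ce_homology R L 3)"
  shows "reduced_koszul_map R L c = \<zero>\<^bsub>Kill\<^esub>"
proof -
  show ?thesis
  proof (rule exists_null_homotopy[OF assms(1) assms(2-4)])
    fix \<Phi>
    assume "\<And>v. v \<in> carrier L \<Longrightarrow> linear_map R L Kill (\<lambda>u. \<Phi> u v)"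
      and "\<And>u. u \<in> carrier L \<Longrightarrow> linear_map R L Kill (\<lambda>v. \<Phi> u v)"
      and "\<And>u. u \<in> carrier L \<Longrightarrow> \<Phi> u u = \<zero>\<^bsub>Kill\<^esub>"
      and "\<And>x y z. x \<in> carrier L \<Longrightarrow> y \<in> carrier L \<Longrightarrow> z \<in> carrier L \<Longrightarrow>
        \<ominus>\<^bsub>Kill\<^esub> \<Phi> \<lbrace>x, y\<rbrace> z \<oplus>\<^bsub>Kill\<^esub> (\<Phi> \<lbrace>x, z\<rbrace> y \<oplus>\<^bsub>Kill\<^esub> \<ominus>\<^bsub>Kill\<^esub> \<Phi> \<lbrace>y, z\<rbrace> x) = \<ominus>\<^bsub>Kill\<^esub> killing_prod x \<lbrace>y, z\<rbrace>"
    from reduced_koszul_map_eq_zero[OF koszul_map_cycle[OF this]] show ?thesis using assms(5) by blast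
  qed
qed

end

theorem corollary1p5:
  fixes R :: "(rat, 'r) module"
    and L :: "('r, 'g) lie"
    and G :: "nat \<Rightarrow> 'g set"
  assumes "algebra (ring_of_type_algebra :: rat ring) R"
    and "lie_algebra R L"
    and "lie_grading_pos R L G"
  shows "\<forall>c \<in> carrier (ce_homology R L 3). reduced_koszul_map R L c = \<zero>\<^bsub>killing_module R L\<^esub>"
proof -
  interpret lie_algebra R L by fact
  interpret A: algebra "ring_of_type_algebra :: rat ring" R by fact
  have Q: "carrier (ring_of_type_algebra :: rat ring) = UNIV" "add (ring_of_type_algebra :: rat ring) = (+)"
    "one (ring_of_type_algebra :: rat ring) = 1"
    by (auto simp: ring_of_type_algebra_def)
  \<comment> \<open>The structure map of the algebra; the module axioms over the rationals make it
    additive and unital.\<close>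
  define \<rho> where "\<rho> p = p \<odot>\<^bsub>R\<^esub> \<one>\<^bsub>R\<^esub>" for p
  have \<rho>: "\<rho> p \<in> carrier R" "\<rho> (p + q) = \<rho> p \<oplus>\<^bsub>R\<^esub> \<rho> q" "\<rho> 1 = \<one>\<^bsub>R\<^esub>" for p q
    using A.smult_closed[of p "\<one>\<^bsub>R\<^esub>"] A.smult_l_distr[of p q "\<one>\<^bsub>R\<^esub>"] A.smult_one[of "\<one>\<^bsub>R\<^esub>"]
    by (simp_all add: \<rho>_def Q)
  show ?thesis using reduced_koszul_map_graded[OF assms(3) \<rho>] by blast
qed

end
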